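(* Let $s\ge 2$, let $n_1<\dots<n_s$ be integers, let $i_1,\dots,i_s$ be positive integers with $r=i_1+\dots+i_s$, and let $E_N=\bigoplus_{k=1}^{s}\mathcal{O}(n_k)^{i_k}$ over $\mathbb{CP}^1$. Put $d_l=n_{l+1}-n_l$, let $z_0=0,z_1,\dots,z_{d_1+\dots+d_{s-1}}$ be arbitrary distinct points of $\mathbb{CP}^1$, and let $$\mathcal{C}_N=\mathcal{F}^{0}_{\lambda_0,[\Pi_0]}\times\left(\prod_{i=1}^{d_1}\mathcal{F}^{i}_{\lambda_1,[\Pi_1]}\right)\times\dots\times\left(\prod_{i=1}^{d_{s-1}}\mathcal{F}^{d_1+\dots+d_{s-2}+i}_{\lambda_{s-1},[\Pi_{s-1}]}\right),$$ where $\mathcal{F}^{i}_{\lambda_l,[\Pi_l]}$ is the Bruhat cell of type $[\Pi_l]$ in the manifold of generalized flags of type $\lambda_l$ in the fiber of $E_N$ over $z_i$. Then, under the action of $\mathrm{Aut}(E_N)$ on $\mathcal{C}_N$ by restriction to fibers, every element of $\mathcal{C}_N$ can be mapped to the special element $$\left(F_{\lambda_0,[\Pi_0]},\underbrace{F_{\lambda_1,[\Pi_1]},\dots,F_{\lambda_1,[\Pi_1]}}_{d_1\text{ times}},\dots,\underbrace{F_{\lambda_{s-1},[\Pi_{s-1}]},\dots,F_{\lambda_{s-1},[\Pi_{s-1}]}}_{d_{s-1}\text{ times}}\right),$$ where $F_{\lambda_l,[\Pi_l]}$ is the class of $\Pi_l$ in $\mathrm{GL}(r,\mathbb{C})/\mathrm{P}_{\lambda_l}$,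 and this special element is stabilized by the subgroup $\mathrm{D}_N\subset\mathrm{Aut}(E_N)$.
   Context: Bundle conventions. $N=\mathrm{diag}(n_1 I_{i_1},\dots,n_s I_{i_s})$, and $E_N$ is given by the transition function $z^N$ between the trivializations over $\mathbb{C}_0=\mathbb{CP}^1\setminus\{\infty\}$ and $\mathbb{C}_1=\mathbb{CP}^1\setminus\{0\}$. An automorphism of $E_N$ is a pair of holomorphic maps $g_i:\mathbb{C}_i\to \mathrm{GL}(r,\mathbb{C})$ with $g_0=z^N g_1z^{-N}$ on $\mathbb{C}^*$; equivalently, a block-lower-triangular matrix polynomial $g_0(z)$ (blocks with respect to $r=i_1+\dots+i_s$) with constant invertible diagonal blocks and with $(j,k)$ block, $j>k$, of degree at most $n_j-n_k$. Fibers over points of $\mathbb{C}_0$ are identified with $\mathbb{C}^r$ by the first trivialization, and the fiber over $\infty$ by the second; the restriction of an automorphism to the fiber over $z$ is $g_0(z)$ if $z\neq\infty$ and $g_1(\infty)$ if $z=\infty$. $\mathrm{D}_N$ is the group of constant invertible block-diagonal matrices. Flags and Bruhat cells. For an ordered partition $\mu: r=p_1+\dots+p_t$, $\mathrm{P}_\mu\subset \mathrm{GL}(r,\mathbb{C})$ is the group of invertible block-lower-triangular matrices with diagonal blocks of sizes $p_1,\dots,p_t$; the flag manifold is $\mathcal{F}_\mu=\mathrm{GL}(r,\mathbb{C})/\mathrm{P}_\mu$ with left action of $\mathrm{GL}(r,\mathbb{C})$. For a permutation matrix $\Pi$ with $\Pi e_k=e_{\sigma(k)}$, $\mathrm{N}^{c}_{\mu,[\Pi]}$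 is the group of lower triangular unipotent matrices whose $(j,k)$ entry, $j>k$, vanishes unless $\sigma^{-1}(j)<\sigma^{-1}(k)$ and $\sigma^{-1}(j),\sigma^{-1}(k)$ lie in different partition intervals $\{p_1+\dots+p_{q-1}+1,\dots,p_1+\dots+p_q\}$ of $\mu$. The Bruhat cell of type $[\Pi]$ is $\mathcal{F}_{\mu,[\Pi]}=\mathrm{N}^{c}_{\mu,[\Pi]}\,\Pi\,\mathrm{P}_\mu/\mathrm{P}_\mu$. Special partitions and permutations. $\lambda_0: r=i_s+\dots+i_1$ and $\Pi_0e_k=e_{r+1-k}$. For $1\le l\le s-1$: $\lambda_l: r=i_{l+1}+\dots+i_s+i_1+\dots+i_l$ and $\Pi_le_k=e_{\tau_l(k)}$ with $\tau_l(k)\equiv k+i_1+\dots+i_l\pmod r$, $\tau_l(k)\in\{1,\dots,r\}$. *)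

theory Defs
  imports
    "HOL-Complex_Analysis.Complex_Analysis"
    "HOL-Algebra.Group_Action"
    "Jordan_Normal_Form.Matrix"
begin

text \<open>
  Rows, columns and basis vectors are numbered from 0, as in the matrix library; the
  summands of the bundle and the parts of an ordered partition are numbered from 1.
\<close>

abbreviation GL :: "nat \<Rightarrow> complex mat monoid" where
  "GL r \<equiv> units_of (ring_mat TYPE(complex) r ())"


subsection \<open>Generalized flags and Bruhat cells\<close>

text \<open>
  An ordered partition is the list of its parts.  \<open>block \<mu> a\<close> is the number \<open>q \<ge> 1\<close> with
  \<open>p\<^sub>1 + \<dots> + p\<^bsub>q-1\<^esub> \<le> a < p\<^sub>1 + \<dots> + p\<^sub>q\<close>; it is meaningful for \<open>a < sum_list \<mu>\<close> only.
\<close>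

definition block :: "nat list \<Rightarrow> nat \<Rightarrow> nat" where
  "block \<mu> a = (LEAST q. a < sum_list (take q \<mu>))"

definition parabolic :: "nat list \<Rightarrow> complex mat set" where
  "parabolic \<mu> = {A \<in> carrier (GL (sum_list \<mu>)).
     \<forall>j<sum_list \<mu>. \<forall>k<sum_list \<mu>. block \<mu> j < block \<mu> k \<longrightarrow> A $$ (j, k) = 0}"

definition perm_matrix :: "nat \<Rightarrow> (nat \<Rightarrow> nat) \<Rightarrow> complex mat" where
  "perm_matrix r \<sigma> = mat r r (\<lambda>(j, k). if j = \<sigma> k then 1 else 0)"

definition bruhat_group :: "nat list \<Rightarrow> (nat \<Rightarrow> nat) \<Rightarrow> complex mat set" where
  "bruhat_group \<mu> \<sigma> = (let r = sum_list \<mu>; \<rho> = inv_into {..<r} \<sigma> in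
     {A \<in> carrier_mat r r.
        (\<forall>j<r. A $$ (j, j) = 1) \<and>
        (\<forall>k<r. \<forall>j<k. A $$ (j, k) = 0) \<and>
        (\<forall>j<r. \<forall>k<j. \<not> (\<rho> j < \<rho> k \<and> block \<mu> (\<rho> j) \<noteq> block \<mu> (\<rho> k)) \<longrightarrow> A $$ (j, k) = 0)})"

text \<open>A flag of type \<open>\<mu>\<close> is a left coset of \<open>parabolic \<mu>\<close>.\<close>

definition bruhat_cell :: "nat list \<Rightarrow> (nat \<Rightarrow> nat) \<Rightarrow> complex mat set set" where
  "bruhat_cell \<mu> \<sigma> = (let r = sum_list \<mu> in
     (\<lambda>A. (A * perm_matrix r \<sigma>) <#\<^bsub>GL r\<^esub> parabolic \<mu>) ` bruhat_group \<mu> \<sigma>)"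

definition special_flag :: "nat list \<Rightarrow> (nat \<Rightarrow> nat) \<Rightarrow> complex mat set" where
  "special_flag \<mu> \<sigma> = (let r = sum_list \<mu> in perm_matrix r \<sigma> <#\<^bsub>GL r\<^esub> parabolic \<mu>)"


subsection \<open>The bundle and its automorphisms\<close>

datatype cp1 = Fin complex | Infty

text \<open>
  The bundle with summands \<open>\<O>(n k)\<^bsup>i k\<^esup>\<close>, \<open>1 \<le> k \<le> s\<close>, is given by \<open>s\<close>, \<open>n\<close> and \<open>i\<close>.
\<close>

definition parts :: "nat \<Rightarrow> (nat \<Rightarrow> nat) \<Rightarrow> nat list" where
  "parts s i = map i [1..<Suc s]"

definition rank :: "nat \<Rightarrow> (nat \<Rightarrow> nat) \<Rightarrow> nat" where
  "rank s i = (\<Sum>k=1..s. i k)"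

definition clutching :: "nat \<Rightarrow> (nat \<Rightarrow> int) \<Rightarrow> (nat \<Rightarrow> nat) \<Rightarrow> complex \<Rightarrow> complex mat" where
  "clutching s n i z = mat (rank s i) (rank s i)
     (\<lambda>(a, b). if a = b then z powi n (block (parts s i) a) else 0)"

definition holomorphic_GL :: "nat \<Rightarrow> (complex \<Rightarrow> complex mat) set" where
  "holomorphic_GL r = {g. (\<forall>z. g z \<in> carrier (GL r)) \<and>
     (\<forall>a<r. \<forall>b<r. (\<lambda>z. g z $$ (a, b)) holomorphic_on UNIV)}"

text \<open>
  In a pair \<open>(g\<^sub>0, g\<^sub>1)\<close> the map \<open>g\<^sub>1\<close> on the complement of 0 is written in the coordinate
  \<open>w = 1 / z\<close>, so that its value at the point at infinity is \<open>g\<^sub>1 0\<close>.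
\<close>

type_synonym bundle_aut = "(complex \<Rightarrow> complex mat) \<times> (complex \<Rightarrow> complex mat)"

definition Aut_bundle :: "nat \<Rightarrow> (nat \<Rightarrow> int) \<Rightarrow> (nat \<Rightarrow> nat) \<Rightarrow> bundle_aut monoid" where
  "Aut_bundle s n i = \<lparr>
     carrier = {(g\<^sub>0, g\<^sub>1). g\<^sub>0 \<in> holomorphic_GL (rank s i) \<and> g\<^sub>1 \<in> holomorphic_GL (rank s i) \<and>
       (\<forall>z. z \<noteq> 0 \<longrightarrow>
          g\<^sub>0 z = clutching s n i z * g\<^sub>1 (1 / z) * clutching s (\<lambda>k. - n k) i z)},
     mult = (\<lambda>(g\<^sub>0, g\<^sub>1) (h\<^sub>0, h\<^sub>1). (\<lambda>z. g\<^sub>0 z * h\<^sub>0 z, \<lambda>w. g\<^sub>1 w * h\<^sub>1 w)),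
     one = (\<lambda>z. 1\<^sub>m (rank s i), \<lambda>w. 1\<^sub>m (rank s i))\<rparr>"

fun fiber_restriction :: "bundle_aut \<Rightarrow> cp1 \<Rightarrow> complex mat" where
  "fiber_restriction (g\<^sub>0, g\<^sub>1) (Fin z) = g\<^sub>0 z"
| "fiber_restriction (g\<^sub>0, g\<^sub>1) Infty = g\<^sub>1 0"

definition D_subgroup :: "nat \<Rightarrow> (nat \<Rightarrow> nat) \<Rightarrow> bundle_aut set" where
  "D_subgroup s i = {(\<lambda>z. A, \<lambda>w. A) | A. A \<in> carrier (GL (rank s i)) \<and>
     (\<forall>a<rank s i. \<forall>b<rank s i.
        block (parts s i) a \<noteq> block (parts s i) b \<longrightarrow> A $$ (a, b) = 0)}"


subsection \<open>The product of Bruhat cells\<close>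

text \<open>
  Since \<open>[i 1, \<dots>, i s]\<close> is the list of parts, \<open>rotate l\<close> gives
  \<open>[i (l+1), \<dots>, i s, i 1, \<dots>, i l]\<close>.
\<close>

definition cell_partition :: "nat \<Rightarrow> (nat \<Rightarrow> nat) \<Rightarrow> nat \<Rightarrow> nat list" where
  "cell_partition s i l = (if l = 0 then rev (parts s i) else rotate l (parts s i))"

definition cell_perm :: "nat \<Rightarrow> (nat \<Rightarrow> nat) \<Rightarrow> nat \<Rightarrow> nat \<Rightarrow> nat" where
  "cell_perm s i l k =
     (if l = 0 then rank s i - 1 - k else (k + (\<Sum>q=1..l. i q)) mod rank s i)"

definition gap :: "(nat \<Rightarrow> int) \<Rightarrow> nat \<Rightarrow> nat" where
  "gap n l = nat (n (Suc l) - n l)"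

definition last_point :: "nat \<Rightarrow> (nat \<Rightarrow> int) \<Rightarrow> nat" where
  "last_point s n = (\<Sum>l=1..s-1. gap n l)"

text \<open>
  The cell over the point with index \<open>m\<close> has type \<open>l \<ge> 1\<close> if
  \<open>d\<^sub>1 + \<dots> + d\<^bsub>l-1\<^esub> < m \<le> d\<^sub>1 + \<dots> + d\<^sub>l\<close>, and type 0 if \<open>m = 0\<close>.
\<close>

definition point_type :: "(nat \<Rightarrow> int) \<Rightarrow> nat \<Rightarrow> nat" where
  "point_type n m = (LEAST l. m \<le> (\<Sum>q=1..l. gap n q))"

text \<open>
  All fibers are identified with \<open>\<complex>\<^sup>r\<close> by the trivializations, so the cells do not depend on
  the points themselves; the action does.
\<close>

definition cell_product ::
    "nat \<Rightarrow> (nat \<Rightarrow> int) \<Rightarrow> (nat \<Rightarrow> nat) \<Rightarrow> (nat \<Rightarrow> complex mat set) set" where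
  "cell_product s n i = (\<Pi>\<^sub>E m\<in>{0..last_point s n}.
     bruhat_cell (cell_partition s i (point_type n m)) (cell_perm s i (point_type n m)))"

definition special_element ::
    "nat \<Rightarrow> (nat \<Rightarrow> int) \<Rightarrow> (nat \<Rightarrow> nat) \<Rightarrow> nat \<Rightarrow> complex mat set" where
  "special_element s n i = (\<lambda>m\<in>{0..last_point s n}.
     special_flag (cell_partition s i (point_type n m)) (cell_perm s i (point_type n m)))"

definition cell_action ::
    "nat \<Rightarrow> (nat \<Rightarrow> int) \<Rightarrow> (nat \<Rightarrow> nat) \<Rightarrow> (nat \<Rightarrow> cp1) \<Rightarrow>
     bundle_aut \<Rightarrow> (nat \<Rightarrow> complex mat set) \<Rightarrow> (nat \<Rightarrow> complex mat set)" where
  "cell_action s n i z g = (\<lambda>F\<in>cell_product s n i. \<lambda>m\<in>{0..last_point s n}.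
     fiber_restriction g (z m) <#\<^bsub>GL (rank s i)\<^esub> F m)"

end

theory Submission
  imports Defs "Jordan_Normal_Form.Determinant"
begin

text \<open>
  By Liouville's theorem an automorphism restricts to block lower triangular matrices on every
  fiber, and every Bruhat cell involved is an orbit of the block lower triangular group: deleting
  the entries that are free in the unipotent group of the cell is a homomorphism from this group
  to the stabilizer of the special flag, so \<open>A\<close> factors as \<open>U C\<close> with \<open>C\<close> the reduced matrix.

  For transitivity one looks for a unipotent automorphism \<open>h\<close> that maps the special element to
  the given flags \<open>U\<^sub>m F\<close>, i.e. \<open>h(z\<^sub>m)\<close> must be \<open>U\<^sub>m\<close> times its own reduced matrix.  This
  prescribes the entry \<open>(j, k)\<close> of \<open>h\<close>, a section of \<open>\<O>(n\<^sub>j - n\<^sub>k)\<close>, at \<open>n\<^sub>j - n\<^sub>k + 1\<close> points, in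
  terms of entries in earlier block rows; so \<open>h\<close> is found by interpolation, row by row.
\<close>

subsection \<open>Subgroups of the general linear group\<close>

text \<open>Demanding \<open>h(z_m) = U_m\<close> at every point would in general impose more
  conditions on an entry than its degree allows. Only \<open>U_m\<close> modulo the stabilizer of
  the special flag matters, so an entry that is not free at \<open>z_m\<close> stays unconstrained
  there. For type l \<ge> 1 the entry (j, k) is free exactly when the cut after block l separates
  the block of k from the block of j. Each of the d_l points of such a type then costs one
  condition. At z_0, of type 0, every entry strictly below the diagonal blocks is free, and this is
  the one remaining condition.

  The equation for \<open>h(z_m)\<close> is linear in \<open>h\<close> and stays within one column:
  the value of the entry (j, k) is a combination of entries (p, k) with p in an earlier block. This
  is why \<open>h\<close> is sought from the special element to the given flags, where the
  coefficients are the known entries of \<open>U_m\<close>; the automorphism in the required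
  direction is the inverse of \<open>h\<close>.\<close>

lemma GL_simps:
  "carrier (GL r) = {A \<in> carrier_mat r r. Determinant.det A \<noteq> 0}"
  "mult (GL r) = (*)"
  "one (GL r) = 1\<^sub>m r"
proof -
  have "A \<in> Units (ring_mat TYPE(complex) r ()) \<longleftrightarrow> A \<in> carrier_mat r r \<and> Determinant.det A \<noteq> 0" for A
    using unit_imp_det_non_zero[of A r "()"] det_non_zero_imp_unit[of A r "()"]
    by (auto simp: Units_def ring_mat_simps)
  then show "carrier (GL r) = {A \<in> carrier_mat r r. Determinant.det A \<noteq> 0}"
    by (auto simp: units_of_carrier)
qed (simp_all add: units_of_mult units_of_one ring_mat_simps)

lemma group_GL: "group (GL r)"
  by (rule monoid.units_group) (rule ring.is_monoid[OF ring_mat])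

lemma GL_carrier_mat: "A \<in> carrier (GL r) \<Longrightarrow> A \<in> carrier_mat r r"
  by (simp add: GL_simps)

lemma GL_I:
  assumes "A \<in> carrier_mat r r" "B \<in> carrier_mat r r" "A * B = 1\<^sub>m r"
  shows "A \<in> carrier (GL r)"
proof -
  have "Determinant.det A * Determinant.det B = 1"
    using det_mult[OF assms(1,2)] assms(3) by simp
  then show ?thesis using assms(1) by (auto simp: GL_simps)
qed

lemma GL_inv:
  assumes "A \<in> carrier (GL r)"
  shows "inv\<^bsub>GL r\<^esub> A \<in> carrier (GL r)" "inv\<^bsub>GL r\<^esub> A * A = 1\<^sub>m r" "A * inv\<^bsub>GL r\<^esub> A = 1\<^sub>m r"
  using group.inv_closed[OF group_GL assms] group.l_inv[OF group_GL assms]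
    group.r_inv[OF group_GL assms] by (simp_all add: GL_simps)

lemma GL_mult: "A \<in> carrier (GL r) \<Longrightarrow> B \<in> carrier (GL r) \<Longrightarrow> A * B \<in> carrier (GL r)"
  using group.is_monoid[OF group_GL, THEN monoid.m_closed, of A r B] by (simp add: GL_simps(2))

lemma GL_assoc:
  "A \<in> carrier (GL r) \<Longrightarrow> B \<in> carrier (GL r) \<Longrightarrow> C \<in> carrier (GL r) \<Longrightarrow> A * B * C = A * (B * C)"
  by (metis assoc_mult_mat GL_carrier_mat)

lemma GL_lcos_assoc:
  assumes "A \<in> carrier (GL r)" "B \<in> carrier (GL r)" "F \<subseteq> carrier (GL r)"
  shows "A <#\<^bsub>GL r\<^esub> (B <#\<^bsub>GL r\<^esub> F) = (A * B) <#\<^bsub>GL r\<^esub> F"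
  using group.lcos_m_assoc[OF group_GL assms(3,1,2)] by (simp add: GL_simps(2))

lemma mult_mat_entry:
  assumes "A \<in> carrier_mat r r" "B \<in> carrier_mat r r" "j < r" "k < r"
  shows "(A * B) $$ (j, k) = (\<Sum>p<r. A $$ (j, p) * B $$ (p, k))"
  using assms by (simp add: scalar_prod_def lessThan_atLeast0)

lemma mult_mat_vec_entry:
  assumes "A \<in> carrier_mat r r" "v \<in> carrier_vec r" "j < r"
  shows "vec_index (A *\<^sub>v v) j = (\<Sum>p<r. A $$ (j, p) * vec_index v p)"
  using assms by (simp add: scalar_prod_def lessThan_atLeast0)

text \<open>The weight \<open>w\<close> takes values in any linear order so that one subgroup lemma
  serves all groups that occur: the parabolic groups, their conjugates by permutation matrices, and,
  with a negated weight, the block upper triangular group.\<close>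

definition block_lower :: "nat \<Rightarrow> (nat \<Rightarrow> 'b::linorder) \<Rightarrow> complex mat set" where
  "block_lower r w = {A \<in> carrier (GL r). \<forall>j<r. \<forall>k<r. w j < w k \<longrightarrow> A $$ (j, k) = 0}"

text \<open>The matrix \<open>M\<close> agrees with \<open>A\<close> on the columns indexed by \<open>T\<close> and with the unit matrix on
  the others.  It is invertible, so the equation \<open>A x = e\<^sub>k\<close> has a solution supported in \<open>T\<close>.\<close>

lemma inverse_block_lower:
  fixes w :: "nat \<Rightarrow> 'b::linorder"
  assumes A: "A \<in> carrier_mat r r" and B: "B \<in> carrier_mat r r" and BA: "B * A = 1\<^sub>m r"
    and low: "\<And>j k. j < r \<Longrightarrow> k < r \<Longrightarrow> w j < w k \<Longrightarrow> A $$ (j, k) = (0::complex)"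
    and jk: "j < r" "k < r" "w j < w k"
  shows "B $$ (j, k) = 0"
proof -
  define T where "T = {a. a < r \<and> w k \<le> w a}"
  define M where "M = mat r r (\<lambda>(a, p). if p \<in> T then A $$ (a, p) else if a = p then 1 else 0)"
  have M: "M \<in> carrier_mat r r" by (simp add: M_def)
  have out: "vec_index (M *\<^sub>v v) a = vec_index v a"
    if "v \<in> carrier_vec r" "a < r" "a \<notin> T" for v a
  proof -
    have "vec_index (M *\<^sub>v v) a = (\<Sum>p<r. M $$ (a, p) * vec_index v p)"
      using mult_mat_vec_entry[OF M that(1,2)] .
    also have "\<dots> = (\<Sum>p<r. if p = a then vec_index v a else 0)"
      using that low[of a] by (intro sum.cong) (auto simp: M_def T_def)
    finally show ?thesis using that by simp
  qed
  have inn: "M *\<^sub>v v = A *\<^sub>v v"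
    if "v \<in> carrier_vec r" "\<And>a. a < r \<Longrightarrow> a \<notin> T \<Longrightarrow> vec_index v a = 0" for v
  proof (rule eq_vecI)
    fix a assume "a < dim_vec (A *\<^sub>v v)"
    then have a: "a < r" using A by simp
    show "vec_index (M *\<^sub>v v) a = vec_index (A *\<^sub>v v) a"
      unfolding mult_mat_vec_entry[OF M that(1) a] mult_mat_vec_entry[OF A that(1) a]
      using that(2) a by (intro sum.cong) (auto simp: M_def)
  qed (use A M in auto)
  have AV: "B *\<^sub>v (A *\<^sub>v v) = v" if "v \<in> carrier_vec r" for v
    using assoc_mult_mat_vec[OF B A that] BA that by simp
  \<comment> \<open>A kernel vector of M vanishes outside T by \<open>out\<close>. On vectors
    supported in T the matrix M acts as A, which has the left inverse B.\<close>
  have "Determinant.det M \<noteq> 0"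
  proof
    assume "Determinant.det M = 0"
    then obtain v where v: "v \<in> carrier_vec r" "v \<noteq> 0\<^sub>v r" "M *\<^sub>v v = 0\<^sub>v r"
      using det_0_iff_vec_prod_zero_field[OF M] by blast
    have "vec_index v a = 0" if "a < r" "a \<notin> T" for a
      using out[OF v(1) that] v(3) that by simp
    then have "A *\<^sub>v v = 0\<^sub>v r" using inn[OF v(1)] v(3) by simp
    then have "v = B *\<^sub>v 0\<^sub>v r" using AV[OF v(1)] by simp
    also have "\<dots> = 0\<^sub>v r" using B by (intro eq_vecI) auto
    finally show False using v(2) by simp
  qed
  then have "M \<in> carrier (GL r)" using M by (simp add: GL_simps)
  from GL_inv[OF this] GL_carrier_mat obtain M' where
    M': "M' \<in> carrier_mat r r" "M * M' = 1\<^sub>m r" by metis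
  define x where "x = M' *\<^sub>v unit_vec r k"
  have x: "x \<in> carrier_vec r" using M' by (auto simp: x_def)
  have Mx: "M *\<^sub>v x = unit_vec r k"
    unfolding x_def using assoc_mult_mat_vec[OF M M'(1), of "unit_vec r k"] M'(2) by simp
  have x0: "vec_index x a = 0" if "a < r" "a \<notin> T" for a
    using out[OF x that] Mx that jk by (cases "a = k") (auto simp: T_def)
  have "B *\<^sub>v unit_vec r k = x" using AV[OF x] inn[OF x x0] Mx by simp
  then have "vec_index (B *\<^sub>v unit_vec r k) j = 0" using x0[of j] jk by (auto simp: T_def)
  then show ?thesis using B jk by (simp add: mult_mat_vec_def scalar_prod_right_unit)
qed

lemma subgroup_block_lower: "subgroup (block_lower r w) (GL r)"
proof (rule group.subgroupI[OF group_GL])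
  show "block_lower r w \<subseteq> carrier (GL r)" by (auto simp: block_lower_def)
  have "1\<^sub>m r \<in> block_lower r w" by (auto simp: block_lower_def GL_simps)
  then show "block_lower r w \<noteq> {}" by auto
next
  fix A assume A: "A \<in> block_lower r w"
  then have Ac: "A \<in> carrier (GL r)" by (auto simp: block_lower_def)
  show "inv\<^bsub>GL r\<^esub> A \<in> block_lower r w"
    using inverse_block_lower[of A r "inv\<^bsub>GL r\<^esub> A" w] A GL_inv[OF Ac]
    by (auto simp: block_lower_def GL_carrier_mat)
next
  fix A B assume A: "A \<in> block_lower r w" and B: "B \<in> block_lower r w"
  have c: "A \<in> carrier (GL r)" "B \<in> carrier (GL r)" using A B by (auto simp: block_lower_def)
  have "(A * B) $$ (j, k) = 0" if "j < r" "k < r" "w j < w k" for j k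
  proof -
    have "A $$ (j, p) * B $$ (p, k) = 0" if "p < r" for p
    proof (cases "w j < w p")
      case True
      then show ?thesis using A that \<open>j < r\<close> by (auto simp: block_lower_def)
    next
      case False
      then have "w p < w k" using \<open>w j < w k\<close> by simp
      then show ?thesis using B that \<open>k < r\<close> by (auto simp: block_lower_def)
    qed
    then show ?thesis
      using that c by (simp add: mult_mat_entry[of A r B] GL_carrier_mat sum.neutral)
  qed
  then show "A \<otimes>\<^bsub>GL r\<^esub> B \<in> block_lower r w"
    using c by (auto simp: block_lower_def GL_simps(2) GL_mult)
qed

lemma parabolic_eq_block_lower: "parabolic \<mu> = block_lower (sum_list \<mu>) (block \<mu>)"
  by (simp add: parabolic_def block_lower_def)

lemma lcos_subgroup_absorb:
  assumes "group G" "subgroup H G" "h \<in> H"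
  shows "h <#\<^bsub>G\<^esub> H = H"
  using group.coset_join3[OF assms(1) _ assms(2,3)] subgroup.mem_carrier[OF assms(2,3)] by blast

section \<open>Permutation matrices and their action on cosets of parabolic groups\<close>

lemma perm_matrix_mult_left:
  assumes "bij_betw \<sigma> {..<r} {..<r}" "A \<in> carrier_mat r r" "j < r" "k < r"
  shows "(perm_matrix r \<sigma> * A) $$ (\<sigma> j, k) = A $$ (j, k)"
proof -
  have s: "\<sigma> j < r" using assms bij_betwE by blast
  have "(perm_matrix r \<sigma> * A) $$ (\<sigma> j, k) = (\<Sum>p<r. perm_matrix r \<sigma> $$ (\<sigma> j, p) * A $$ (p, k))"
    using assms s by (intro mult_mat_entry) (auto simp: perm_matrix_def)
  also have "\<dots> = (\<Sum>p<r. if p = j then A $$ (j, k) else 0)"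
    using assms s by (intro sum.cong) (auto simp: perm_matrix_def bij_betw_def inj_on_def)
  finally show ?thesis using assms by simp
qed

lemma perm_matrix_mult_right:
  assumes "bij_betw \<sigma> {..<r} {..<r}" "A \<in> carrier_mat r r" "j < r" "k < r"
  shows "(A * perm_matrix r \<sigma>) $$ (j, k) = A $$ (j, \<sigma> k)"
proof -
  have s: "\<sigma> k < r" using assms bij_betwE by blast
  have "(A * perm_matrix r \<sigma>) $$ (j, k) = (\<Sum>p<r. A $$ (j, p) * perm_matrix r \<sigma> $$ (p, k))"
    using assms by (intro mult_mat_entry) (auto simp: perm_matrix_def)
  also have "\<dots> = (\<Sum>p<r. if p = \<sigma> k then A $$ (j, p) else 0)"
    using assms s by (intro sum.cong) (auto simp: perm_matrix_def)
  finally show ?thesis using s by simp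
qed

lemma perm_matrix_GL:
  assumes "bij_betw \<sigma> {..<r} {..<r}"
  shows "perm_matrix r \<sigma> \<in> carrier (GL r)"
proof (rule GL_I)
  let ?\<rho> = "inv_into {..<r} \<sigma>"
  show c: "perm_matrix r \<sigma> \<in> carrier_mat r r" "perm_matrix r ?\<rho> \<in> carrier_mat r r"
    by (auto simp: perm_matrix_def)
  have \<rho>: "bij_betw ?\<rho> {..<r} {..<r}" using assms by (rule bij_betw_inv_into)
  have \<rho>\<sigma>: "?\<rho> k < r" "\<sigma> (?\<rho> k) = k" if "k < r" for k
    using that bij_betwE[OF \<rho>] bij_betw_inv_into_right[OF assms, of k] by auto
  show "perm_matrix r \<sigma> * perm_matrix r ?\<rho> = 1\<^sub>m r"
  proof (rule eq_matI)
    fix j k assume "j < dim_row (1\<^sub>m r :: complex mat)" "k < dim_col (1\<^sub>m r :: complex mat)"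
    then show "(perm_matrix r \<sigma> * perm_matrix r ?\<rho>) $$ (j, k) = 1\<^sub>m r $$ (j, k)"
      using perm_matrix_mult_right[OF \<rho> c(1)] \<rho>\<sigma> by (auto simp: perm_matrix_def)
  qed (auto simp: perm_matrix_def)
qed

text \<open>Conjugating C by the permutation matrix P relabels the entry (\<sigma> j, \<sigma> k) as
  (j, k). The weight \<open>block \<mu>\<close> composed with the inverse of \<sigma> thereby
  becomes \<open>block \<mu>\<close> itself, so \<open>C * P = P * C'\<close> with \<open>C'\<close>
  in the parabolic group.\<close>

lemma perm_matrix_lcos_absorb:
  assumes r: "r = sum_list \<mu>" and \<sigma>: "bij_betw \<sigma> {..<r} {..<r}"
    and C: "C \<in> block_lower r (\<lambda>a. block \<mu> (inv_into {..<r} \<sigma> a))"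
  shows "(C * perm_matrix r \<sigma>) <#\<^bsub>GL r\<^esub> parabolic \<mu> = perm_matrix r \<sigma> <#\<^bsub>GL r\<^esub> parabolic \<mu>"
proof -
  let ?P = "perm_matrix r \<sigma>"
  have P: "?P \<in> carrier (GL r)" using \<sigma> by (rule perm_matrix_GL)
  have Cc: "C \<in> carrier (GL r)" using C by (auto simp: block_lower_def)
  define C' where "C' = inv\<^bsub>GL r\<^esub> ?P * (C * ?P)"
  have C'c: "C' \<in> carrier (GL r)" using P Cc by (simp add: C'_def GL_mult GL_inv)
  have eq: "?P * C' = C * ?P"
  proof -
    have "?P * C' = ?P * inv\<^bsub>GL r\<^esub> ?P * (C * ?P)"
      unfolding C'_def using P Cc by (intro GL_assoc[symmetric]) (auto simp: GL_mult GL_inv)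
    also have "\<dots> = C * ?P" using left_mult_one_mat[OF GL_carrier_mat[OF GL_mult[OF Cc P]]] P by (simp add: GL_inv)
    finally show ?thesis .
  qed
  have "C' $$ (j, k) = 0" if "j < r" "k < r" "block \<mu> j < block \<mu> k" for j k
  proof -
    have "\<sigma> j < r" "\<sigma> k < r" using that bij_betwE[OF \<sigma>] by auto
    moreover have "inv_into {..<r} \<sigma> (\<sigma> j) = j" "inv_into {..<r} \<sigma> (\<sigma> k) = k"
      using that bij_betw_inv_into_left[OF \<sigma>] by auto
    ultimately have "C $$ (\<sigma> j, \<sigma> k) = 0" using C that by (auto simp: block_lower_def)
    then have "(?P * C') $$ (\<sigma> j, k) = 0"
      unfolding eq using perm_matrix_mult_right[OF \<sigma> _ \<open>\<sigma> j < r\<close> that(2)] Cc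
      by (simp add: GL_carrier_mat)
    then show ?thesis
      using perm_matrix_mult_left[OF \<sigma> _ that(1,2), of C'] C'c by (simp add: GL_carrier_mat)
  qed
  then have C': "C' \<in> parabolic \<mu>"
    using C'c r by (auto simp: parabolic_eq_block_lower block_lower_def)
  have sub: "subgroup (parabolic \<mu>) (GL r)"
    unfolding parabolic_eq_block_lower r by (rule subgroup_block_lower)
  have "(C * ?P) <#\<^bsub>GL r\<^esub> parabolic \<mu> = ?P <#\<^bsub>GL r\<^esub> (C' <#\<^bsub>GL r\<^esub> parabolic \<mu>)"
    using GL_lcos_assoc[OF P C'c subgroup.subset[OF sub]] eq by simp
  also have "C' <#\<^bsub>GL r\<^esub> parabolic \<mu> = parabolic \<mu>"
    using lcos_subgroup_absorb[OF group_GL sub C'] .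
  finally show ?thesis .
qed

subsection \<open>Interpolation by sections of line bundles\<close>

text \<open>Newton's induction: a multiple of the product of the factors \<open>y - a\<close>
  corrects the value at the new point and keeps the old ones. The bound is put on coefficients
  instead of the degree so that the empty set yields the zero polynomial.\<close>

lemma lagrange_interpolation:
  fixes v :: "complex \<Rightarrow> complex"
  assumes "finite X"
  shows "\<exists>p. (\<forall>k\<ge>card X. coeff p k = 0) \<and> (\<forall>x\<in>X. poly p x = v x)"
  using assms
proof (induction X)
  case empty
  show ?case by (rule exI[of _ 0]) simp
next
  case (insert x X)
  then obtain p where p: "\<forall>k\<ge>card X. coeff p k = 0" "\<forall>x\<in>X. poly p x = v x" by blast
  define q where "q = (\<Prod>a\<in>X. [:- a, 1:])"
  have q: "poly q y = (\<Prod>a\<in>X. y - a)" for y by (simp add: q_def poly_prod)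
  have "degree q \<le> card X"
    using degree_prod_sum_le[OF insert.hyps(1), of "\<lambda>a. [:- a, 1:]"] by (simp add: q_def o_def)
  moreover have "poly q x \<noteq> 0" using insert.hyps by (auto simp: q)
  moreover have "poly q y = 0" if "y \<in> X" for y using insert.hyps that by (simp add: q)
  ultimately show ?case
    using p insert.hyps
    by (intro exI[of _ "p + Polynomial.smult ((v x - poly p x) / poly q x) q"]) (auto simp: coeff_eq_0)
qed

text \<open>The value at a point of the section of \<open>\<O>(d)\<close> given by a polynomial of degree at most \<open>d\<close>,
  in the trivialization that \<^const>\<open>fiber_restriction\<close> uses over that point.\<close>

fun section_value :: "nat \<Rightarrow> complex poly \<Rightarrow> cp1 \<Rightarrow> complex" where
  "section_value d p (Fin z) = poly p z"
| "section_value d p Infty = coeff p d"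

lemma section_interpolation:
  fixes v :: "cp1 \<Rightarrow> complex"
  assumes "finite X" "card X \<le> Suc d"
  shows "\<exists>p. degree p \<le> d \<and> (\<forall>x\<in>X. section_value d p x = v x)"
proof -
  define Y where "Y = {z. Fin z \<in> X}"
  define c where "c = (if Infty \<in> X then v Infty else 0)"
  have img: "Fin ` Y = X - {Infty}"
  proof (intro Set.set_eqI)
    show "x \<in> Fin ` Y \<longleftrightarrow> x \<in> X - {Infty}" for x by (cases x) (auto simp: Y_def)
  qed
  have inj: "inj_on Fin Y" by (simp add: inj_on_def)
  have fin: "finite Y" using assms(1) img finite_imageD[OF _ inj] by simp
  have card: "card Y = card (X - {Infty})" using card_image[OF inj] img by simp
  have less: "card Y \<le> d" if "Infty \<in> X"
    using card card_Suc_Diff1[OF assms(1) that] assms(2) by simp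
  obtain p where p: "\<forall>k\<ge>card Y. coeff p k = 0" "\<forall>z\<in>Y. poly p z = v (Fin z) - c * z ^ d"
    using lagrange_interpolation[OF fin, of "\<lambda>z. v (Fin z) - c * z ^ d"] by blast
  have le: "card Y \<le> Suc d" using card assms card_Diff1_le[of X Infty] by simp
  have "degree (p + monom c d) \<le> d"
    using p(1) le by (intro degree_le allI impI) auto
  moreover have "section_value d (p + monom c d) x = v x" if "x \<in> X" for x
  proof (cases x)
    case (Fin z)
    then show ?thesis using p(2) that by (simp add: Y_def poly_monom)
  next
    case Infty
    then show ?thesis using p(1) less that by (simp add: c_def)
  qed
  ultimately show ?thesis by blast
qed

subsection \<open>Positions of rows in the partitions\<close>

lemma sum_list_take_mono:
  "p \<le> q \<Longrightarrow> sum_list (take p \<mu>) \<le> (sum_list (take q \<mu>) :: nat)"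
  by (auto simp: take_add dest!: le_Suc_ex)

text \<open>Replaces the \<open>LEAST\<close> by thresholds: from here on, statements about blocks
  become comparisons with partial sums of the parts.\<close>

lemma block_le_iff:
  assumes "a < sum_list \<mu>"
  shows "block \<mu> a \<le> q \<longleftrightarrow> a < sum_list (take q \<mu>)"
proof
  have "a < sum_list (take (block \<mu> a) \<mu>)"
    unfolding block_def by (rule LeastI[of _ "length \<mu>"]) (use assms in simp)
  then show "a < sum_list (take q \<mu>)" if "block \<mu> a \<le> q"
    using sum_list_take_mono[OF that, of \<mu>] by simp
next
  show "block \<mu> a \<le> q" if "a < sum_list (take q \<mu>)"
    unfolding block_def using that by (rule Least_le)
qed

lemma block_mono: "a \<le> a' \<Longrightarrow> a' < sum_list \<mu> \<Longrightarrow> block \<mu> a \<le> block \<mu> a'"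
  using block_le_iff[of a \<mu> "block \<mu> a'"] block_le_iff[of a' \<mu> "block \<mu> a'"] by simp

lemma block_bounds: "a < sum_list \<mu> \<Longrightarrow> 1 \<le> block \<mu> a \<and> block \<mu> a \<le> length \<mu>"
  using block_le_iff[of a \<mu> 0] block_le_iff[of a \<mu> "length \<mu>"] by simp

lemma length_parts: "length (parts s i) = s"
  by (simp add: parts_def)

lemma sum_list_take_parts:
  "sum_list (take q (parts s i)) = (\<Sum>k=1..min q s. i k)"
  by (simp add: parts_def take_map take_upt sum_list_distinct_conv_sum_set
      atLeastLessThanSuc_atLeastAtMost min_def del: upt_Suc)

lemma sum_list_parts: "sum_list (parts s i) = rank s i"
  using sum_list_take_parts[of s s i] by (simp add: length_parts rank_def)

lemma sum_list_drop_nat: "sum_list (drop q \<mu>) = sum_list \<mu> - (sum_list (take q \<mu>) :: nat)"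
  by (metis add_diff_cancel_left' append_take_drop_id sum_list_append)

lemma sum_list_cell_partition: "sum_list (cell_partition s i l) = rank s i"
proof -
  have "sum_list (drop k \<mu> @ take k \<mu>) = sum_list \<mu>" for k and \<mu> :: "nat list"
    by (metis add.commute append_take_drop_id sum_list_append)
  then show ?thesis
    by (simp add: cell_partition_def rotate_drop_take sum_list_parts sum_list_rev
        del: sum_list_append)
qed

lemma sum_parts_le_rank: "l \<le> s \<Longrightarrow> (\<Sum>q=1..l. i q) \<le> rank s i"
  unfolding rank_def by (intro sum_mono2) auto

lemma cell_perm_less: "k < rank s i \<Longrightarrow> cell_perm s i l k < rank s i"
  by (auto simp: cell_perm_def)

text \<open>The explicit inverse of \<open>cell_perm\<close> on the rows. For l > 0 it undoes the
  cyclic shift, with the reduction modulo the rank resolved into two cases.\<close>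

definition cell_position :: "nat \<Rightarrow> (nat \<Rightarrow> nat) \<Rightarrow> nat \<Rightarrow> nat \<Rightarrow> nat" where
  "cell_position s i l j = (if l = 0 then rank s i - 1 - j
     else if (\<Sum>q=1..l. i q) \<le> j then j - (\<Sum>q=1..l. i q)
     else j + rank s i - (\<Sum>q=1..l. i q))"

lemma cell_position:
  assumes "l \<le> s" "j < rank s i"
  shows "cell_position s i l j < rank s i" "cell_perm s i l (cell_position s i l j) = j"
  using assms sum_parts_le_rank[OF assms(1), of i] by (auto simp: cell_position_def cell_perm_def)

lemma bij_cell_perm:
  assumes "l \<le> s"
  shows "bij_betw (cell_perm s i l) {..<rank s i} {..<rank s i}"
proof -
  have "{..<rank s i} \<subseteq> cell_perm s i l ` {..<rank s i}"
  proof
    fix j assume "j \<in> {..<rank s i}"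
    then show "j \<in> cell_perm s i l ` {..<rank s i}"
      using cell_position[OF assms, of j i] by (intro image_eqI[of _ _ "cell_position s i l j"]) auto
  qed
  then have "cell_perm s i l ` {..<rank s i} = {..<rank s i}"
    using cell_perm_less[of _ s i l] by auto
  then show ?thesis by (simp add: bij_betw_def eq_card_imp_inj_on)
qed

lemma inv_cell_perm:
  assumes "l \<le> s" "j < rank s i"
  shows "inv_into {..<rank s i} (cell_perm s i l) j = cell_position s i l j"
  using bij_betw_inv_into_left[OF bij_cell_perm[OF assms(1)], of "cell_position s i l j" i]
    cell_position[OF assms] by simp

text \<open>Block numbers are known only through their thresholds, and the partial sums are
  manageable only for q up to the number of blocks. Equality is therefore tested on this range
  alone.\<close>

lemma nat_eq_if_le_iff:
  assumes "x \<le> (m::nat)" "y \<le> m" "\<And>q. q \<le> m \<Longrightarrow> x \<le> q \<longleftrightarrow> y \<le> q"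
  shows "x = y"
  using assms by (meson order_antisym order_refl)

lemma block_parts_le_iff:
  "a < rank s i \<Longrightarrow> q \<le> s \<Longrightarrow> block (parts s i) a \<le> q \<longleftrightarrow> a < (\<Sum>k=1..q. i k)"
  by (simp add: block_le_iff sum_list_parts sum_list_take_parts)

lemma block_parts_bounds:
  "a < rank s i \<Longrightarrow> 1 \<le> block (parts s i) a \<and> block (parts s i) a \<le> s"
  using block_bounds[of a "parts s i"] by (simp add: sum_list_parts length_parts)

text \<open>The stabilizer of the special flag of type \<open>l\<close> is block lower triangular for this weight.\<close>

definition cell_weight :: "nat \<Rightarrow> (nat \<Rightarrow> nat) \<Rightarrow> nat \<Rightarrow> nat \<Rightarrow> nat" where
  "cell_weight s i l a =
     block (cell_partition s i l) (inv_into {..<rank s i} (cell_perm s i l) a)"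

text \<open>The permutation reverses the rows and the partition reverses the parts, so block b is
  carried to block s + 1 - b.\<close>

lemma cell_weight_0:
  assumes a: "a < rank s i"
  shows "cell_weight s i 0 a = Suc s - block (parts s i) a"
proof (rule nat_eq_if_le_iff)
  let ?p = "cell_position s i 0 a"
  have p: "?p < rank s i" using cell_position(1)[OF le0 a] .
  have w: "cell_weight s i 0 a = block (rev (parts s i)) ?p"
    using inv_cell_perm[OF le0 a] by (simp add: cell_weight_def cell_partition_def)
  have b: "1 \<le> block (parts s i) a" "block (parts s i) a \<le> s" using block_parts_bounds[OF a] by auto
  show "Suc s - block (parts s i) a \<le> s" using b by simp
  show "cell_weight s i 0 a \<le> s"
    unfolding w using block_bounds[of ?p "rev (parts s i)"] p
    by (simp add: sum_list_rev sum_list_parts length_parts)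
  fix q assume q: "q \<le> s"
  have le: "(\<Sum>k=1..s-q. i k) \<le> rank s i" by (rule sum_parts_le_rank) simp
  have "cell_weight s i 0 a \<le> q \<longleftrightarrow> ?p < sum_list (take q (rev (parts s i)))"
    unfolding w using p by (intro block_le_iff) (simp add: sum_list_rev sum_list_parts)
  also have "sum_list (take q (rev (parts s i))) = rank s i - (\<Sum>k=1..s-q. i k)"
    by (simp add: take_rev sum_list_rev sum_list_drop_nat sum_list_parts sum_list_take_parts
        length_parts)
  also have "?p < rank s i - (\<Sum>k=1..s-q. i k) \<longleftrightarrow> \<not> a < (\<Sum>k=1..s-q. i k)"
    using a le by (auto simp: cell_position_def)
  also have "\<dots> \<longleftrightarrow> Suc s - block (parts s i) a \<le> q"
    using block_parts_le_iff[OF a, of "s - q"] b q by auto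
  finally show "cell_weight s i 0 a \<le> q \<longleftrightarrow> Suc s - block (parts s i) a \<le> q" .
qed

text \<open>The cyclic shift is matched to the rotation of the parts: blocks l+1, ..., s move to the
  front as 1, ..., s-l, and blocks 1, ..., l follow them as s-l+1, ..., s.\<close>

lemma cell_weight_pos:
  assumes l: "0 < l" "l < s" and a: "a < rank s i"
  shows "cell_weight s i l a =
    (if l < block (parts s i) a then block (parts s i) a - l else block (parts s i) a + (s - l))"
    (is "_ = ?w")
proof (rule nat_eq_if_le_iff)
  define S where "S q = (\<Sum>k=1..q. i k)" for q
  let ?p = "cell_position s i l a" and ?b = "block (parts s i) a"
  have ls: "l \<le> s" using l by simp
  have p: "?p < rank s i" using cell_position(1)[OF ls a] .
  have w: "cell_weight s i l a = block (rotate l (parts s i)) ?p"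
    using inv_cell_perm[OF ls a] l by (simp add: cell_weight_def cell_partition_def)
  have sl: "sum_list (rotate l (parts s i)) = rank s i"
    using sum_list_cell_partition[of s i l] l by (simp add: cell_partition_def)
  have b: "1 \<le> ?b" "?b \<le> s" using block_parts_bounds[OF a] by auto
  show "?w \<le> s" using b l by auto
  show "cell_weight s i l a \<le> s"
    unfolding w using block_bounds[of ?p "rotate l (parts s i)"] p
    by (simp add: sl length_parts)
  have pos: "?p = (if S l \<le> a then a - S l else a + rank s i - S l)"
    using l by (simp add: cell_position_def S_def)
  have rank: "S q \<le> rank s i" if "q \<le> s" for q
    unfolding S_def using that by (rule sum_parts_le_rank)
  have mono: "S q \<le> S q'" if "q \<le> q'" for q q'
    unfolding S_def using that by (intro sum_mono2) auto
  have bS: "?b \<le> q \<longleftrightarrow> a < S q" if "q \<le> s" for q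
    unfolding S_def using block_parts_le_iff[OF a that] .
  fix q assume q: "q \<le> s"
  have rot: "rotate l (parts s i) = drop l (parts s i) @ take l (parts s i)"
    using l by (simp add: rotate_drop_take length_parts)
  have "cell_weight s i l a \<le> q \<longleftrightarrow> ?p < sum_list (take q (rotate l (parts s i)))"
    unfolding w using p by (intro block_le_iff) (simp add: sl)
  also have "\<dots> \<longleftrightarrow> ?w \<le> q"
  \<comment> \<open>For q \<le> s - l the first q parts of the rotated list lie among i_(l+1), ...,
    i_s; for larger q they contain all of these and wrap around to i_1, i_2, and so on.\<close>
  proof (cases "q \<le> s - l")
    case True
    have "sum_list (take q (rotate l (parts s i))) = S (l + q) - S l"
    proof -
      have "sum_list (take l (parts s i)) + sum_list (take q (drop l (parts s i)))
          = sum_list (take (l + q) (parts s i))"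
        by (simp add: take_add)
      then show ?thesis
        using True l by (simp add: rot length_parts sum_list_take_parts S_def min_def split: if_splits)
    qed
    moreover have lq: "l + q \<le> s" using True l by simp
    ultimately show ?thesis
      using True l bS[OF ls] bS[OF lq] rank[OF lq] mono[of l "l + q"] b a
      unfolding pos by (cases "S l \<le> a") (simp_all, linarith+)
  next
    case False
    have "sum_list (take q (rotate l (parts s i))) = rank s i - S l + S (q - (s - l))"
      using False l q by (simp add: rot length_parts sum_list_take_parts sum_list_drop_nat sum_list_parts
          S_def min_def)
    moreover have qs: "q - (s - l) \<le> s" using q by simp
    ultimately show ?thesis
      using False l q bS[OF ls] bS[OF qs] rank[OF ls] b a
      unfolding pos by (cases "S l \<le> a") (simp_all, linarith+)
  qed
  finally show "cell_weight s i l a \<le> q \<longleftrightarrow> ?w \<le> q" .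
qed

text \<open>The places below the diagonal where the unipotent group of the cell may be nonzero,
  expressed by the blocks of the bundle instead of the permutation; \<open>bruhat_group_iff\<close>
  justifies this description.\<close>

definition cell_free :: "nat \<Rightarrow> (nat \<Rightarrow> nat) \<Rightarrow> nat \<Rightarrow> nat \<Rightarrow> nat \<Rightarrow> bool" where
  "cell_free s i l j k \<longleftrightarrow> block (parts s i) k < block (parts s i) j \<and>
     (l = 0 \<or> block (parts s i) k \<le> l \<and> l < block (parts s i) j)"

text \<open>Passing from the block order to the order of the weights reverses exactly the free pairs
  and keeps the order of all other pairs.\<close>

lemma cell_weight_less_iff:
  assumes "l < s" "j < rank s i" "k < rank s i"
  shows "cell_weight s i l j < cell_weight s i l k \<longleftrightarrow>
    (block (parts s i) j < block (parts s i) k \<and> \<not> cell_free s i l k j) \<or> cell_free s i l j k"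
proof (cases "l = 0")
  case True
  then show ?thesis
    using assms block_parts_bounds[OF assms(2)] block_parts_bounds[OF assms(3)]
    by (auto simp: cell_free_def cell_weight_0)
next
  case False
  then show ?thesis
    using assms block_parts_bounds[OF assms(2)] block_parts_bounds[OF assms(3)]
    by (auto simp: cell_free_def cell_weight_pos)
qed

text \<open>Blocks do not decrease along positions, so a smaller position in a different block means
  a strictly smaller weight. For k < j the block of k is at most that of j, which leaves only
  freeness from \<open>cell_weight_less_iff\<close>; conversely a free place (j, k) has k <
  j.\<close>

lemma bruhat_group_iff:
  assumes l: "l < s"
  shows "A \<in> bruhat_group (cell_partition s i l) (cell_perm s i l) \<longleftrightarrow>
    A \<in> carrier_mat (rank s i) (rank s i) \<and>
    (\<forall>j<rank s i. \<forall>k<rank s i. \<not> cell_free s i l j k \<longrightarrow> A $$ (j, k) = (if j = k then 1 else 0))"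
proof -
  let ?r = "rank s i" and ?\<mu> = "cell_partition s i l"
  define \<rho> where "\<rho> = inv_into {..<?r} (cell_perm s i l)"
  have \<rho>: "\<rho> j < ?r" if "j < ?r" for j
    using bij_betwE[OF bij_betw_inv_into[OF bij_cell_perm]] l that by (simp add: \<rho>_def less_imp_le)
  have eq: "k < j \<and> \<rho> j < \<rho> k \<and> block ?\<mu> (\<rho> j) \<noteq> block ?\<mu> (\<rho> k) \<longleftrightarrow> cell_free s i l j k"
    if jk: "j < ?r" "k < ?r" for j k
  proof -
    have "\<rho> j < \<rho> k \<and> block ?\<mu> (\<rho> j) \<noteq> block ?\<mu> (\<rho> k) \<longleftrightarrow> block ?\<mu> (\<rho> j) < block ?\<mu> (\<rho> k)"
      using block_mono[of "\<rho> j" "\<rho> k" ?\<mu>] block_mono[of "\<rho> k" "\<rho> j" ?\<mu>] \<rho>[OF jk(1)] \<rho>[OF jk(2)]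
      unfolding sum_list_cell_partition by linarith
    also have "\<dots> \<longleftrightarrow> cell_weight s i l j < cell_weight s i l k"
      by (simp add: cell_weight_def \<rho>_def)
    also have "\<dots> \<longleftrightarrow> (block (parts s i) j < block (parts s i) k \<and> \<not> cell_free s i l k j)
        \<or> cell_free s i l j k"
      using cell_weight_less_iff[OF l jk] .
    finally have *: "\<rho> j < \<rho> k \<and> block ?\<mu> (\<rho> j) \<noteq> block ?\<mu> (\<rho> k) \<longleftrightarrow>
      (block (parts s i) j < block (parts s i) k \<and> \<not> cell_free s i l k j) \<or> cell_free s i l j k" .
    have "block (parts s i) j \<le> block (parts s i) k" if "\<not> k < j"
      using block_mono[of j k "parts s i"] that jk by (simp add: sum_list_parts)
    moreover have "block (parts s i) k \<le> block (parts s i) j" if "k < j"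
      using block_mono[of k j "parts s i"] that jk by (simp add: sum_list_parts)
    moreover have "block (parts s i) k < block (parts s i) j" if "cell_free s i l j k"
      using that by (simp add: cell_free_def)
    ultimately show ?thesis using * by (meson leD)
  qed
  have nf: "\<not> cell_free s i l j j" for j by (simp add: cell_free_def)
  show ?thesis
    unfolding bruhat_group_def Let_def sum_list_cell_partition \<rho>_def[symmetric] mem_Collect_eq
  proof (intro conj_cong refl iffI)
    assume A: "(\<forall>j<?r. A $$ (j, j) = 1) \<and> (\<forall>k<?r. \<forall>j<k. A $$ (j, k) = 0) \<and>
      (\<forall>j<?r. \<forall>k<j. \<not> (\<rho> j < \<rho> k \<and> block ?\<mu> (\<rho> j) \<noteq> block ?\<mu> (\<rho> k)) \<longrightarrow> A $$ (j, k) = 0)"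
    show "\<forall>j<?r. \<forall>k<?r. \<not> cell_free s i l j k \<longrightarrow> A $$ (j, k) = (if j = k then 1 else 0)"
    proof (intro allI impI)
      fix j k assume "j < ?r" "k < ?r" "\<not> cell_free s i l j k"
      then show "A $$ (j, k) = (if j = k then 1 else 0)"
        using A eq[of j k] by (cases j k rule: linorder_cases) auto
    qed
  next
    assume A: "\<forall>j<?r. \<forall>k<?r. \<not> cell_free s i l j k \<longrightarrow> A $$ (j, k) = (if j = k then 1 else 0)"
    have "A $$ (j, k) = 0" if "j < ?r" "k < ?r" "j \<noteq> k"
      "\<not> (k < j \<and> \<rho> j < \<rho> k \<and> block ?\<mu> (\<rho> j) \<noteq> block ?\<mu> (\<rho> k))" for j k
      using A that eq[of j k] by auto
    then show "(\<forall>j<?r. A $$ (j, j) = 1) \<and> (\<forall>k<?r. \<forall>j<k. A $$ (j, k) = 0) \<and>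
      (\<forall>j<?r. \<forall>k<j. \<not> (\<rho> j < \<rho> k \<and> block ?\<mu> (\<rho> j) \<noteq> block ?\<mu> (\<rho> k)) \<longrightarrow> A $$ (j, k) = 0)"
      using A nf by auto
  qed
qed


subsection \<open>The cells as orbits\<close>

abbreviation block_group :: "nat \<Rightarrow> (nat \<Rightarrow> nat) \<Rightarrow> complex mat set" where
  "block_group s i \<equiv> block_lower (rank s i) (block (parts s i))"

text \<open>For l > 0 the block lower triangular group lies in the parabolic group with the single
  cut after block l, and this map restricts the projection onto the Levi factor of that parabolic
  group. For l = 0 it is the projection onto the block diagonal matrices.\<close>

definition strip :: "nat \<Rightarrow> (nat \<Rightarrow> nat) \<Rightarrow> nat \<Rightarrow> complex mat \<Rightarrow> complex mat" where
  "strip s i l A = mat (rank s i) (rank s i) (\<lambda>(j, k). if cell_free s i l j k then 0 else A $$ (j, k))"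

lemma strip_carrier: "strip s i l A \<in> carrier_mat (rank s i) (rank s i)"
  by (simp add: strip_def)

lemma strip_entry:
  "j < rank s i \<Longrightarrow> k < rank s i \<Longrightarrow>
    strip s i l A $$ (j, k) = (if cell_free s i l j k then 0 else A $$ (j, k))"
  by (simp add: strip_def)

lemma block_groupD:
  assumes "A \<in> block_group s i"
  shows "A \<in> carrier (GL (rank s i))" "A \<in> carrier_mat (rank s i) (rank s i)"
    "\<And>j k. j < rank s i \<Longrightarrow> k < rank s i \<Longrightarrow> block (parts s i) j < block (parts s i) k \<Longrightarrow> A $$ (j, k) = 0"
  using assms GL_carrier_mat by (auto simp: block_lower_def)

text \<open>A cut separates the ends of a chain of blocks exactly when it separates two neighbours
  in it; in type 0, the ends differ exactly when one of the two steps is strict. The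
  multiplicativity of \<open>strip\<close> rests on this.\<close>

lemma cell_free_split:
  assumes "block (parts s i) k \<le> block (parts s i) p" "block (parts s i) p \<le> block (parts s i) j"
  shows "cell_free s i l j k \<longleftrightarrow> cell_free s i l j p \<or> cell_free s i l p k"
  using assms by (auto simp: cell_free_def)

text \<open>Only indices p whose block lies between those of k and j contribute. If (j, k) is not
  free, neither is (p, k), so no contributing entry of B has been deleted.\<close>

lemma mult_strip_entry:
  assumes A: "A \<in> block_group s i" and B: "B \<in> block_group s i"
    and jk: "j < rank s i" "k < rank s i" "\<not> cell_free s i l j k"
  shows "(A * strip s i l B) $$ (j, k) = (A * B) $$ (j, k)"
proof -
  have "A $$ (j, p) * strip s i l B $$ (p, k) = A $$ (j, p) * B $$ (p, k)" if p: "p < rank s i" for p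
  proof (cases "block (parts s i) k \<le> block (parts s i) p \<and> block (parts s i) p \<le> block (parts s i) j")
    case True
    then show ?thesis using cell_free_split[of s i k p j l] jk p by (simp add: strip_entry)
  next
    case False
    then show ?thesis
      using block_groupD(3)[OF A jk(1) p] block_groupD(3)[OF B p jk(2)] jk p
      by (auto simp: strip_entry not_le)
  qed
  then show ?thesis
    unfolding mult_mat_entry[OF block_groupD(2)[OF A] block_groupD(2)[OF B] jk(1,2)]
      mult_mat_entry[OF block_groupD(2)[OF A] strip_carrier jk(1,2)]
    by (intro sum.cong) auto
qed

text \<open>For every contributing p, a free place (j, k) forces (j, p) or (p, k) to be free, so the
  term on the right is deleted; if (j, k) is not free, both factors survive.\<close>

lemma strip_mult:
  assumes A: "A \<in> block_group s i" and B: "B \<in> block_group s i"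
  shows "strip s i l (A * B) = strip s i l A * strip s i l B"
proof (rule eq_matI)
  fix j k assume "j < dim_row (strip s i l A * strip s i l B)" "k < dim_col (strip s i l A * strip s i l B)"
  then have jk: "j < rank s i" "k < rank s i" by (auto simp: strip_def)
  have "strip s i l A $$ (j, p) * strip s i l B $$ (p, k)
      = (if cell_free s i l j k then 0 else A $$ (j, p) * B $$ (p, k))" if p: "p < rank s i" for p
  proof (cases "block (parts s i) k \<le> block (parts s i) p \<and> block (parts s i) p \<le> block (parts s i) j")
    case True
    then show ?thesis using cell_free_split[of s i k p j l] jk p by (auto simp: strip_entry)
  next
    case False
    then show ?thesis
      using block_groupD(3)[OF A jk(1) p] block_groupD(3)[OF B p jk(2)] jk p
      by (auto simp: strip_entry not_le)
  qed
  then show "strip s i l (A * B) $$ (j, k) = (strip s i l A * strip s i l B) $$ (j, k)"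
    unfolding strip_entry[OF jk] mult_mat_entry[OF strip_carrier strip_carrier jk]
      mult_mat_entry[OF block_groupD(2)[OF A] block_groupD(2)[OF B] jk]
    by (cases "cell_free s i l j k") (simp_all add: sum.neutral)
qed (simp_all add: strip_def)

lemma strip_one: "strip s i l (1\<^sub>m (rank s i)) = 1\<^sub>m (rank s i)"
  by (rule eq_matI) (auto simp: strip_def cell_free_def)

lemma block_group_inv:
  assumes "A \<in> block_group s i"
  shows "inv\<^bsub>GL (rank s i)\<^esub> A \<in> block_group s i"
  using subgroup.m_inv_closed[OF subgroup_block_lower assms] .

lemma block_group_mult:
  "A \<in> block_group s i \<Longrightarrow> B \<in> block_group s i \<Longrightarrow> A * B \<in> block_group s i"
  using subgroup.m_closed[OF subgroup_block_lower] by (simp add: GL_simps(2))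

text \<open>By \<open>cell_weight_less_iff\<close> the entries that have to vanish are either above
  the diagonal blocks, where A vanishes, or free, where they were deleted. Invertibility is
  inherited because \<open>strip\<close> maps the inverse of A to an inverse.\<close>

lemma strip_stabilizes:
  assumes l: "l < s" and A: "A \<in> block_group s i"
  shows "strip s i l A \<in> block_lower (rank s i) (cell_weight s i l)"
proof -
  have "strip s i l A * strip s i l (inv\<^bsub>GL (rank s i)\<^esub> A) = 1\<^sub>m (rank s i)"
    using strip_mult[OF A block_group_inv[OF A], of l] GL_inv[OF block_groupD(1)[OF A]]
    by (simp add: strip_one)
  then have "strip s i l A \<in> carrier (GL (rank s i))"
    by (intro GL_I[OF strip_carrier strip_carrier])
  then show ?thesis
    using block_groupD(3)[OF A]
    by (auto simp: block_lower_def strip_entry cell_weight_less_iff[OF l])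
qed

lemma unitriangular_GL:
  assumes "A \<in> carrier_mat r r" "\<And>j. j < r \<Longrightarrow> A $$ (j, j) = 1"
    and "\<And>j k. j < k \<Longrightarrow> k < r \<Longrightarrow> A $$ (j, k) = 0"
  shows "A \<in> carrier (GL r)"
proof -
  have "Determinant.det A = prod_list (diag_mat A)"
    using assms by (intro det_lower_triangular[of r]) auto
  also have "diag_mat A = map (\<lambda>_. 1) [0..<r]"
    using assms by (intro nth_equalityI) (auto simp: diag_mat_def)
  finally show ?thesis using assms(1) by (simp add: GL_simps map_replicate_const prod_list_replicate)
qed

lemma bruhat_group_block_group:
  assumes l: "l < s" and U: "U \<in> bruhat_group (cell_partition s i l) (cell_perm s i l)"
  shows "U \<in> block_group s i"
proof -
  let ?r = "rank s i"
  have Uc: "U \<in> carrier_mat ?r ?r"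
    and Ue: "\<And>j k. j < ?r \<Longrightarrow> k < ?r \<Longrightarrow> \<not> cell_free s i l j k \<Longrightarrow> U $$ (j, k) = (if j = k then 1 else 0)"
    using U by (auto simp: bruhat_group_iff[OF l])
  have free: "\<not> cell_free s i l j k" if "j \<le> k" "k < ?r" for j k
    using block_mono[OF that(1), of "parts s i"] that by (simp add: sum_list_parts cell_free_def)
  have "U \<in> carrier (GL ?r)"
    using Ue free Uc by (intro unitriangular_GL) auto
  then show ?thesis
    using Ue by (auto simp: block_lower_def cell_free_def)
qed

text \<open>Away from the free places U agrees with the product of A and its inverse, by
  \<open>mult_strip_entry\<close>. The factorization follows because the two stripped matrices are
  inverse to each other.\<close>

lemma unipotent_factor:
  assumes l: "l < s" and A: "A \<in> block_group s i"
  defines "U \<equiv> A * strip s i l (inv\<^bsub>GL (rank s i)\<^esub> A)"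
  shows "U \<in> bruhat_group (cell_partition s i l) (cell_perm s i l)" "A = U * strip s i l A"
proof -
  let ?r = "rank s i" and ?B = "inv\<^bsub>GL (rank s i)\<^esub> A"
  have B: "?B \<in> block_group s i" using A by (rule block_group_inv)
  have inv: "A * ?B = 1\<^sub>m ?r" "?B * A = 1\<^sub>m ?r" using GL_inv[OF block_groupD(1)[OF A]] by auto
  have "U $$ (j, k) = (if j = k then 1 else 0)" if "j < ?r" "k < ?r" "\<not> cell_free s i l j k" for j k
    using mult_strip_entry[OF A B that] that inv by (simp add: U_def)
  moreover have "U \<in> carrier_mat ?r ?r"
    using block_groupD(2)[OF A] strip_carrier by (auto simp: U_def intro: mult_carrier_mat)
  ultimately show "U \<in> bruhat_group (cell_partition s i l) (cell_perm s i l)"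
    by (auto simp: bruhat_group_iff[OF l])
  have "U * strip s i l A = A * (strip s i l ?B * strip s i l A)"
    unfolding U_def using block_groupD(2)[OF A] strip_carrier by (intro assoc_mult_mat)
  also have "\<dots> = A"
    unfolding strip_mult[OF B A, symmetric] inv strip_one
    using block_groupD(2)[OF A] by simp
  finally show "A = U * strip s i l A" by simp
qed

section \<open>Special flags, their stabilizers and the orbits that form the cells\<close>

abbreviation flag_of :: "nat \<Rightarrow> (nat \<Rightarrow> nat) \<Rightarrow> nat \<Rightarrow> complex mat set" where
  "flag_of s i l \<equiv> special_flag (cell_partition s i l) (cell_perm s i l)"

abbreviation cell_of :: "nat \<Rightarrow> (nat \<Rightarrow> nat) \<Rightarrow> nat \<Rightarrow> complex mat set set" where
  "cell_of s i l \<equiv> bruhat_cell (cell_partition s i l) (cell_perm s i l)"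

lemma parabolic_cell_subset: "parabolic (cell_partition s i l) \<subseteq> carrier (GL (rank s i))"
  by (auto simp: parabolic_def sum_list_cell_partition)

lemma lcos_flag:
  assumes "l < s" "A \<in> carrier (GL (rank s i))"
  shows "A <#\<^bsub>GL (rank s i)\<^esub> flag_of s i l =
    (A * perm_matrix (rank s i) (cell_perm s i l)) <#\<^bsub>GL (rank s i)\<^esub> parabolic (cell_partition s i l)"
  using GL_lcos_assoc[OF assms(2) perm_matrix_GL[OF bij_cell_perm] parabolic_cell_subset] assms(1)
  by (simp add: special_flag_def sum_list_cell_partition Let_def)

lemma flag_of_subset: "l < s \<Longrightarrow> flag_of s i l \<subseteq> carrier (GL (rank s i))"
  unfolding special_flag_def sum_list_cell_partition Let_def
  by (intro group.l_coset_subset_G[OF group_GL] parabolic_cell_subset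
      perm_matrix_GL bij_cell_perm) simp

lemma flag_of_stabilizer:
  assumes "l < s" "C \<in> block_lower (rank s i) (cell_weight s i l)"
  shows "C <#\<^bsub>GL (rank s i)\<^esub> flag_of s i l = flag_of s i l"
proof -
  have C: "C \<in> carrier (GL (rank s i))" using assms(2) by (simp add: block_lower_def)
  show ?thesis
    unfolding lcos_flag[OF assms(1) C] unfolding special_flag_def sum_list_cell_partition Let_def
    using assms bij_cell_perm[of l s i]
    by (intro perm_matrix_lcos_absorb)
       (simp_all add: sum_list_cell_partition cell_weight_def[abs_def])
qed

text \<open>The factor \<open>strip s i l A\<close> fixes the special flag. U is kept arbitrary so
  that the statement covers both the factorization of a given A and the prescribed U in the
  construction of an automorphism.\<close>

lemma lcos_flag_eq:
  assumes l: "l < s" and A: "A \<in> block_group s i"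
    and U: "U \<in> bruhat_group (cell_partition s i l) (cell_perm s i l)" and eq: "A = U * strip s i l A"
  shows "A <#\<^bsub>GL (rank s i)\<^esub> flag_of s i l = U <#\<^bsub>GL (rank s i)\<^esub> flag_of s i l"
proof -
  have Uc: "U \<in> carrier (GL (rank s i))" using block_groupD(1)[OF bruhat_group_block_group[OF l U]] .
  have C: "strip s i l A \<in> block_lower (rank s i) (cell_weight s i l)" using strip_stabilizes[OF l A] .
  then have "strip s i l A \<in> carrier (GL (rank s i))" by (simp add: block_lower_def)
  then show ?thesis
    using GL_lcos_assoc[OF Uc _ flag_of_subset[OF l], of "strip s i l A"] flag_of_stabilizer[OF l C]
    unfolding eq[symmetric] by simp
qed

lemma cell_of_eq_image:
  assumes l: "l < s"
  shows "cell_of s i l = (\<lambda>U. U <#\<^bsub>GL (rank s i)\<^esub> flag_of s i l) `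
    bruhat_group (cell_partition s i l) (cell_perm s i l)"
  unfolding bruhat_cell_def sum_list_cell_partition Let_def
  using lcos_flag[OF l] bruhat_group_block_group[OF l] block_groupD(1)
  by (intro image_cong) auto

lemma cell_of_eq_orbit:
  assumes l: "l < s"
  shows "cell_of s i l = (\<lambda>A. A <#\<^bsub>GL (rank s i)\<^esub> flag_of s i l) ` block_group s i"
proof -
  have "A <#\<^bsub>GL (rank s i)\<^esub> flag_of s i l \<in> cell_of s i l" if "A \<in> block_group s i" for A
    using lcos_flag_eq[OF l that unipotent_factor[OF l that]] unipotent_factor(1)[OF l that]
    by (auto simp: cell_of_eq_image[OF l])
  then show ?thesis using bruhat_group_block_group[OF l] cell_of_eq_image[OF l] by auto
qed

lemma cell_of_subset:
  assumes l: "l < s" and F: "F \<in> cell_of s i l"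
  shows "F \<subseteq> carrier (GL (rank s i))"
proof -
  obtain A where "A \<in> block_group s i" "F = A <#\<^bsub>GL (rank s i)\<^esub> flag_of s i l"
    using F by (auto simp: cell_of_eq_orbit[OF l])
  then show ?thesis
    using group.l_coset_subset_G[OF group_GL flag_of_subset[OF l] block_groupD(1)] by simp
qed

lemma flag_of_in_cell:
  assumes l: "l < s"
  shows "flag_of s i l \<in> cell_of s i l"
proof -
  let ?r = "rank s i"
  have "1\<^sub>m ?r \<in> block_group s i"
    using subgroup.one_closed[OF subgroup_block_lower, of ?r] by (simp add: GL_simps(3))
  moreover have "1\<^sub>m ?r <#\<^bsub>GL ?r\<^esub> flag_of s i l = flag_of s i l"
    using group.lcos_mult_one[OF group_GL flag_of_subset[OF l], of i] by (simp add: GL_simps(3))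
  ultimately show ?thesis unfolding cell_of_eq_orbit[OF l] by (metis image_eqI)
qed

lemma lcos_cell_closed:
  assumes l: "l < s" and A: "A \<in> block_group s i" and F: "F \<in> cell_of s i l"
  shows "A <#\<^bsub>GL (rank s i)\<^esub> F \<in> cell_of s i l"
proof -
  obtain B where B: "B \<in> block_group s i" "F = B <#\<^bsub>GL (rank s i)\<^esub> flag_of s i l"
    using F by (auto simp: cell_of_eq_orbit[OF l])
  then have "A <#\<^bsub>GL (rank s i)\<^esub> F = (A * B) <#\<^bsub>GL (rank s i)\<^esub> flag_of s i l"
    using GL_lcos_assoc[OF block_groupD(1)[OF A] block_groupD(1)[OF B(1)] flag_of_subset[OF l]] by simp
  then show ?thesis using block_group_mult[OF A B(1)] by (auto simp: cell_of_eq_orbit[OF l])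
qed

subsection \<open>The automorphism group\<close>

text \<open>Conjugation by the clutching matrix, entry by entry: the factor at (a, b) is the
  transition function of a line bundle whose degree is the difference of the degrees of the two
  summands.\<close>

definition twist :: "nat \<Rightarrow> (nat \<Rightarrow> int) \<Rightarrow> (nat \<Rightarrow> nat) \<Rightarrow> complex \<Rightarrow> complex mat \<Rightarrow> complex mat" where
  "twist s n i z A = mat (rank s i) (rank s i)
     (\<lambda>(a, b). z powi (n (block (parts s i) a) - n (block (parts s i) b)) * A $$ (a, b))"

lemma twist_carrier: "twist s n i z A \<in> carrier_mat (rank s i) (rank s i)"
  by (simp add: twist_def)

lemma twist_entry:
  "a < rank s i \<Longrightarrow> b < rank s i \<Longrightarrow>
    twist s n i z A $$ (a, b) = z powi (n (block (parts s i) a) - n (block (parts s i) b)) * A $$ (a, b)"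
  by (simp add: twist_def)

lemma clutching_conj:
  assumes "z \<noteq> 0" and A: "A \<in> carrier_mat (rank s i) (rank s i)"
  shows "clutching s n i z * A * clutching s (\<lambda>k. - n k) i z = twist s n i z A"
proof (rule eq_matI)
  let ?r = "rank s i"
  have c: "clutching s m i z \<in> carrier_mat ?r ?r" for m by (simp add: clutching_def)
  fix a b assume "a < dim_row (twist s n i z A)" "b < dim_col (twist s n i z A)"
  then have ab: "a < ?r" "b < ?r" by (simp_all add: twist_def)
  have left: "(clutching s n i z * A) $$ (a, p) = z powi n (block (parts s i) a) * A $$ (a, p)"
    if p: "p < ?r" for p
  proof -
    have "(clutching s n i z * A) $$ (a, p) =
        (\<Sum>q<?r. if q = a then z powi n (block (parts s i) a) * A $$ (q, p) else 0)"
      unfolding mult_mat_entry[OF c A ab(1) p]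
      using ab by (intro sum.cong) (auto simp: clutching_def)
    then show ?thesis using ab by simp
  qed
  have "(clutching s n i z * A * clutching s (\<lambda>k. - n k) i z) $$ (a, b) =
      (\<Sum>p<?r. if p = b then z powi n (block (parts s i) a) * A $$ (a, p) *
        z powi (- n (block (parts s i) b)) else 0)"
    unfolding mult_mat_entry[OF mult_carrier_mat[OF c A] c ab]
    using ab left by (intro sum.cong) (auto simp: clutching_def)
  also have "\<dots> = twist s n i z A $$ (a, b)"
    using ab assms(1) by (simp add: twist_entry power_int_diff power_int_minus divide_simps)
  finally show "(clutching s n i z * A * clutching s (\<lambda>k. - n k) i z) $$ (a, b) = twist s n i z A $$ (a, b)" .
qed (auto simp: clutching_def twist_def)

lemma twist_mult:
  assumes z: "z \<noteq> 0" and A: "A \<in> carrier_mat (rank s i) (rank s i)"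
    and B: "B \<in> carrier_mat (rank s i) (rank s i)"
  shows "twist s n i z (A * B) = twist s n i z A * twist s n i z B"
proof (rule eq_matI)
  let ?b = "\<lambda>a. n (block (parts s i) a)"
  fix a b assume "a < dim_row (twist s n i z A * twist s n i z B)" "b < dim_col (twist s n i z A * twist s n i z B)"
  then have ab: "a < rank s i" "b < rank s i" by (simp_all add: twist_def)
  have "z powi (?b a - ?b b) = z powi (?b a - ?b p) * z powi (?b p - ?b b)" for p
    using z by (simp add: power_int_add[symmetric])
  then have "z powi (?b a - ?b b) * (A $$ (a, p) * B $$ (p, b)) =
      twist s n i z A $$ (a, p) * twist s n i z B $$ (p, b)" if "p < rank s i" for p
    unfolding twist_entry[OF ab(1) that] twist_entry[OF that ab(2)] by (metis mult.assoc mult.left_commute)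
  then show "twist s n i z (A * B) $$ (a, b) = (twist s n i z A * twist s n i z B) $$ (a, b)"
    unfolding mult_mat_entry[OF twist_carrier twist_carrier ab] twist_entry[OF ab]
      mult_mat_entry[OF A B ab] sum_distrib_left
    by (intro sum.cong) auto
qed (simp_all add: twist_def)

lemma twist_one: "twist s n i z (1\<^sub>m (rank s i)) = 1\<^sub>m (rank s i)"
  by (rule eq_matI) (auto simp: twist_def)

lemma twist_inv:
  assumes z: "z \<noteq> 0" and A: "A \<in> carrier (GL (rank s i))" and tA: "twist s n i z A \<in> carrier (GL (rank s i))"
  shows "inv\<^bsub>GL (rank s i)\<^esub> (twist s n i z A) = twist s n i z (inv\<^bsub>GL (rank s i)\<^esub> A)"
proof -
  let ?B = "inv\<^bsub>GL (rank s i)\<^esub> A"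
  have B: "?B \<in> carrier (GL (rank s i))" using GL_inv(1)[OF A] .
  have eq: "twist s n i z ?B * twist s n i z A = 1\<^sub>m (rank s i)"
    unfolding twist_mult[OF z GL_carrier_mat[OF B] GL_carrier_mat[OF A], symmetric] GL_inv(2)[OF A]
    by (rule twist_one)
  have "twist s n i z ?B \<in> carrier (GL (rank s i))"
    using GL_I[OF twist_carrier twist_carrier eq] .
  then show ?thesis
    using group.inv_equality[OF group_GL, of "rank s i" "twist s n i z ?B" "twist s n i z A"] eq tA
    by (simp add: GL_simps(2,3))
qed

lemma Aut_bundle_carrier:
  "(g\<^sub>0, g\<^sub>1) \<in> carrier (Aut_bundle s n i) \<longleftrightarrow>
    g\<^sub>0 \<in> holomorphic_GL (rank s i) \<and> g\<^sub>1 \<in> holomorphic_GL (rank s i) \<and>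
    (\<forall>z. z \<noteq> 0 \<longrightarrow> g\<^sub>0 z = twist s n i z (g\<^sub>1 (1 / z)))"
proof -
  have "clutching s n i z * g\<^sub>1 (1 / z) * clutching s (\<lambda>k. - n k) i z = twist s n i z (g\<^sub>1 (1 / z))"
    if "g\<^sub>1 \<in> holomorphic_GL (rank s i)" "z \<noteq> 0" for z
    using clutching_conj[OF that(2), of "g\<^sub>1 (1 / z)"] that(1)
    by (simp add: holomorphic_GL_def GL_carrier_mat)
  then show ?thesis by (auto simp: Aut_bundle_def)
qed

section \<open>Holomorphy of products and inverses, and the group of automorphisms\<close>

lemma holomorphic_det:
  assumes "\<And>z. f z \<in> carrier_mat m m"
    and "\<And>a b. a < m \<Longrightarrow> b < m \<Longrightarrow> (\<lambda>z. f z $$ (a, b)) holomorphic_on S"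
  shows "(\<lambda>z. Determinant.det (f z) :: complex) holomorphic_on S"
  unfolding det_def'[OF assms(1)]
  by (intro holomorphic_intros assms(2)) (auto simp: permutes_in_image)

lemma holomorphic_GL_D:
  assumes "g \<in> holomorphic_GL r"
  shows "g z \<in> carrier (GL r)" "g z \<in> carrier_mat r r"
    "a < r \<Longrightarrow> b < r \<Longrightarrow> (\<lambda>z. g z $$ (a, b)) holomorphic_on UNIV"
  using assms by (auto simp: holomorphic_GL_def GL_carrier_mat)

lemma holomorphic_GL_mult:
  assumes g: "g \<in> holomorphic_GL r" and h: "h \<in> holomorphic_GL r"
  shows "(\<lambda>z. g z * h z) \<in> holomorphic_GL r"
proof -
  have "(\<lambda>z. (g z * h z) $$ (a, b)) holomorphic_on UNIV" if "a < r" "b < r" for a b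
    unfolding mult_mat_entry[OF holomorphic_GL_D(2)[OF g] holomorphic_GL_D(2)[OF h] that]
    using that by (intro holomorphic_intros holomorphic_GL_D(3)[OF g] holomorphic_GL_D(3)[OF h]) auto
  then show ?thesis
    using GL_mult[OF holomorphic_GL_D(1)[OF g] holomorphic_GL_D(1)[OF h]]
    by (simp add: holomorphic_GL_def)
qed

text \<open>Cramer's rule. The inverse in the group is defined abstractly; this formula shows that
  its entries depend holomorphically on those of A.\<close>

lemma GL_inv_adj:
  assumes A: "A \<in> carrier (GL r)" and ab: "a < r" "b < r"
  shows "(inv\<^bsub>GL r\<^esub> A) $$ (a, b) = cofactor A b a / Determinant.det A"
proof -
  let ?B = "inv\<^bsub>GL r\<^esub> A"
  have Ac: "A \<in> carrier_mat r r" and Bc: "?B \<in> carrier_mat r r"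
    using A GL_inv(1)[OF A] by (auto simp: GL_carrier_mat)
  have "Determinant.det A \<cdot>\<^sub>m ?B = (adj_mat A * A) * ?B"
    using adj_mat[OF Ac] Bc by (simp add: mult_smult_assoc_mat[of _ r r])
  also have "\<dots> = adj_mat A * (A * ?B)" using adj_mat(1)[OF Ac] Ac Bc by (intro assoc_mult_mat)
  also have "\<dots> = adj_mat A" using GL_inv(3)[OF A] adj_mat(1)[OF Ac] by simp
  finally have "(Determinant.det A \<cdot>\<^sub>m ?B) $$ (a, b) = adj_mat A $$ (a, b)" by simp
  then show ?thesis using A ab Ac Bc by (simp add: GL_simps adj_mat_def field_simps)
qed

lemma holomorphic_GL_inv:
  assumes g: "g \<in> holomorphic_GL r"
  shows "(\<lambda>z. inv\<^bsub>GL r\<^esub> (g z)) \<in> holomorphic_GL r"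
proof -
  have "(\<lambda>z. (inv\<^bsub>GL r\<^esub> (g z)) $$ (a, b)) holomorphic_on UNIV" if ab: "a < r" "b < r" for a b
  proof -
    have "(\<lambda>z. Determinant.det (mat_delete (g z) b a)) holomorphic_on UNIV"
    proof (rule holomorphic_det[of _ "r - 1"])
      show "mat_delete (g z) b a \<in> carrier_mat (r - 1) (r - 1)" for z
        using holomorphic_GL_D(2)[OF g, of z] by (simp add: mat_delete_def)
      fix p q assume pq: "p < r - 1" "q < r - 1"
      have "mat_delete (g z) b a $$ (p, q) =
          g z $$ (if p < b then p else Suc p, if q < a then q else Suc q)" for z
        using holomorphic_GL_D(2)[OF g, of z] pq by (simp add: mat_delete_def)
      then show "(\<lambda>z. mat_delete (g z) b a $$ (p, q)) holomorphic_on UNIV"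
        using holomorphic_GL_D(3)[OF g] pq by simp
    qed
    moreover have "(\<lambda>z. Determinant.det (g z)) holomorphic_on UNIV"
      using holomorphic_GL_D[OF g] by (intro holomorphic_det) auto
    moreover have "Determinant.det (g z) \<noteq> 0" for z
      using holomorphic_GL_D(1)[OF g, of z] by (simp add: GL_simps)
    ultimately show ?thesis
      unfolding GL_inv_adj[OF holomorphic_GL_D(1)[OF g] ab] cofactor_def
      by (intro holomorphic_intros) auto
  qed
  then show ?thesis
    using GL_inv(1)[OF holomorphic_GL_D(1)[OF g]] by (simp add: holomorphic_GL_def)
qed

lemma holomorphic_GL_const: "A \<in> carrier (GL r) \<Longrightarrow> (\<lambda>z. A) \<in> holomorphic_GL r"
  by (simp add: holomorphic_GL_def)

lemma one_GL: "1\<^sub>m r \<in> carrier (GL r)"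
  by (simp add: GL_simps)

lemma Aut_bundle_inv_closed:
  assumes "(g\<^sub>0, g\<^sub>1) \<in> carrier (Aut_bundle s n i)"
  shows "(\<lambda>z. inv\<^bsub>GL (rank s i)\<^esub> (g\<^sub>0 z), \<lambda>w. inv\<^bsub>GL (rank s i)\<^esub> (g\<^sub>1 w)) \<in> carrier (Aut_bundle s n i)"
proof -
  have g: "g\<^sub>0 \<in> holomorphic_GL (rank s i)" "g\<^sub>1 \<in> holomorphic_GL (rank s i)"
    "\<And>z. z \<noteq> 0 \<Longrightarrow> g\<^sub>0 z = twist s n i z (g\<^sub>1 (1 / z))"
    using assms by (auto simp: Aut_bundle_carrier)
  have "inv\<^bsub>GL (rank s i)\<^esub> (g\<^sub>0 z) = twist s n i z (inv\<^bsub>GL (rank s i)\<^esub> (g\<^sub>1 (1 / z)))" if "z \<noteq> 0" for z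
    using twist_inv[OF that holomorphic_GL_D(1)[OF g(2)], of n "1 / z"]
      holomorphic_GL_D(1)[OF g(1), of z] g(3)[OF that] by simp
  then show ?thesis
    using g by (simp add: Aut_bundle_carrier holomorphic_GL_inv)
qed

lemma Aut_bundle_mult:
  "g \<otimes>\<^bsub>Aut_bundle s n i\<^esub> h = (\<lambda>z. fst g z * fst h z, \<lambda>w. snd g w * snd h w)"
  by (simp add: Aut_bundle_def split_beta)

lemma Aut_bundle_one: "\<one>\<^bsub>Aut_bundle s n i\<^esub> = (\<lambda>z. 1\<^sub>m (rank s i), \<lambda>w. 1\<^sub>m (rank s i))"
  by (simp add: Aut_bundle_def)

lemma Aut_bundle_group: "group (Aut_bundle s n i)"
proof (rule groupI)
  let ?G = "Aut_bundle s n i" and ?r = "rank s i"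
  show "\<one>\<^bsub>?G\<^esub> \<in> carrier ?G"
    by (simp add: Aut_bundle_one Aut_bundle_carrier holomorphic_GL_const one_GL twist_one)
  fix g assume "g \<in> carrier ?G"
  moreover obtain g\<^sub>0 g\<^sub>1 where eg: "g = (g\<^sub>0, g\<^sub>1)" by (cases g)
  ultimately have gc: "(g\<^sub>0, g\<^sub>1) \<in> carrier ?G" by simp
  then have g: "g\<^sub>0 \<in> holomorphic_GL ?r" "g\<^sub>1 \<in> holomorphic_GL ?r"
    "\<And>z. z \<noteq> 0 \<Longrightarrow> g\<^sub>0 z = twist s n i z (g\<^sub>1 (1 / z))"
    by (auto simp: Aut_bundle_carrier)
  show "\<one>\<^bsub>?G\<^esub> \<otimes>\<^bsub>?G\<^esub> g = g"
    unfolding Aut_bundle_one Aut_bundle_mult eg fst_conv snd_conv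
      left_mult_one_mat[OF holomorphic_GL_D(2)[OF g(1)]]
      left_mult_one_mat[OF holomorphic_GL_D(2)[OF g(2)]] ..
  show "\<exists>h\<in>carrier ?G. h \<otimes>\<^bsub>?G\<^esub> g = \<one>\<^bsub>?G\<^esub>"
    using GL_inv(2)[OF holomorphic_GL_D(1)[OF g(1)]] GL_inv(2)[OF holomorphic_GL_D(1)[OF g(2)]]
    by (intro bexI[OF _ Aut_bundle_inv_closed[OF gc]]) (simp add: Aut_bundle_one Aut_bundle_mult eg)
  fix h assume "h \<in> carrier ?G"
  moreover obtain h\<^sub>0 h\<^sub>1 where eh: "h = (h\<^sub>0, h\<^sub>1)" by (cases h)
  ultimately have h: "h\<^sub>0 \<in> holomorphic_GL ?r" "h\<^sub>1 \<in> holomorphic_GL ?r"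
    "\<And>z. z \<noteq> 0 \<Longrightarrow> h\<^sub>0 z = twist s n i z (h\<^sub>1 (1 / z))"
    by (auto simp: Aut_bundle_carrier)
  show "g \<otimes>\<^bsub>?G\<^esub> h \<in> carrier ?G"
    using g h twist_mult[OF _ holomorphic_GL_D(2)[OF g(2)] holomorphic_GL_D(2)[OF h(2)]]
    by (simp add: Aut_bundle_mult eg eh Aut_bundle_carrier holomorphic_GL_mult)
  fix k assume "k \<in> carrier ?G"
  moreover obtain k\<^sub>0 k\<^sub>1 where ek: "k = (k\<^sub>0, k\<^sub>1)" by (cases k)
  ultimately have k: "k\<^sub>0 \<in> holomorphic_GL ?r" "k\<^sub>1 \<in> holomorphic_GL ?r"
    by (auto simp: Aut_bundle_carrier)
  show "g \<otimes>\<^bsub>?G\<^esub> h \<otimes>\<^bsub>?G\<^esub> k = g \<otimes>\<^bsub>?G\<^esub> (h \<otimes>\<^bsub>?G\<^esub> k)"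
    unfolding Aut_bundle_mult eg eh ek
    using GL_assoc[OF holomorphic_GL_D(1)[OF g(1)] holomorphic_GL_D(1)[OF h(1)] holomorphic_GL_D(1)[OF k(1)]]
      GL_assoc[OF holomorphic_GL_D(1)[OF g(2)] holomorphic_GL_D(1)[OF h(2)] holomorphic_GL_D(1)[OF k(2)]]
    by simp
qed

text \<open>Since k < 0 and h is continuous at 0, f tends to 0 at infinity, so Liouville's theorem
  gives f = 0. The relation then makes h vanish away from 0, and continuity extends this to 0, which
  is the value in the fiber at infinity.\<close>

lemma section_of_negative_bundle_zero:
  fixes f h :: "complex \<Rightarrow> complex"
  assumes f: "f holomorphic_on UNIV" and h: "h holomorphic_on UNIV" and k: "k < 0"
    and eq: "\<And>z. z \<noteq> 0 \<Longrightarrow> f z = z powi k * h (1 / z)"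
  shows "f z = 0" "h w = 0"
proof -
  define m where "m = nat (- k)"
  have m: "m > 0" "k = - int m" using k by (auto simp: m_def)
  have eq': "f z = inverse z ^ m * h (inverse z)" if "z \<noteq> 0" for z
    using eq[OF that] by (simp add: m(2) power_int_minus power_one_over inverse_eq_divide)
  have cont: "isCont h 0"
    using h by (metis holomorphic_on_imp_continuous_on continuous_on_eq_continuous_at open_UNIV UNIV_I)
  have "((\<lambda>z. inverse z ^ m * h (inverse z)) \<longlongrightarrow> 0 ^ m * h 0) at_infinity"
    by (intro tendsto_mult tendsto_power tendsto_inverse_0 isCont_tendsto_compose[OF cont])
  moreover have "eventually (\<lambda>z. f z = inverse z ^ m * h (inverse z)) at_infinity"
    unfolding eventually_at_infinity by (rule exI[of _ 1]) (auto intro!: eq')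
  ultimately have "(f \<longlongrightarrow> 0) at_infinity"
    using m(1) by (simp add: tendsto_cong zero_power)
  then have f0: "f z = 0" for z by (rule Liouville_weak_0[OF f])
  then show "f z = 0" .
  have h0: "h w = 0" if "w \<noteq> 0" for w
    using eq'[of "inverse w"] f0 that by simp
  have "(h \<longlongrightarrow> 0) (at 0)"
    by (rule tendsto_eventually) (auto simp: eventually_at_filter h0)
  then have "h 0 = 0" using cont LIM_unique unfolding isCont_def by blast
  then show "h w = 0" using h0 by (cases "w = 0") auto
qed

text \<open>An entry above the diagonal blocks is a section of a line bundle of negative degree.
  Both trivializations are treated, so the fiber at infinity is included.\<close>

lemma Aut_bundle_block_group:
  assumes n: "strict_mono_on {1..s} n" and g: "g \<in> carrier (Aut_bundle s n i)"
  shows "fiber_restriction g x \<in> block_group s i"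
proof -
  obtain g\<^sub>0 g\<^sub>1 where eg: "g = (g\<^sub>0, g\<^sub>1)" by (cases g)
  have gg: "g\<^sub>0 \<in> holomorphic_GL (rank s i)" "g\<^sub>1 \<in> holomorphic_GL (rank s i)"
    "\<And>z. z \<noteq> 0 \<Longrightarrow> g\<^sub>0 z = twist s n i z (g\<^sub>1 (1 / z))"
    using g by (auto simp: eg Aut_bundle_carrier)
  have z: "g\<^sub>0 z $$ (a, b) = 0" "g\<^sub>1 w $$ (a, b) = 0"
    if ab: "a < rank s i" "b < rank s i" "block (parts s i) a < block (parts s i) b" for a b z w
  proof -
    have "n (block (parts s i) a) < n (block (parts s i) b)"
      using n ab block_parts_bounds[OF ab(1)] block_parts_bounds[OF ab(2)]
      by (auto simp: strict_mono_on_def)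
    then have k: "n (block (parts s i) a) - n (block (parts s i) b) < 0" by simp
    have "g\<^sub>0 z $$ (a, b) = z powi (n (block (parts s i) a) - n (block (parts s i) b)) * g\<^sub>1 (1 / z) $$ (a, b)"
      if "z \<noteq> 0" for z
      using gg(3)[OF that] ab by (simp add: twist_entry)
    note section_of_negative_bundle_zero[OF holomorphic_GL_D(3)[OF gg(1) ab(1,2)]
        holomorphic_GL_D(3)[OF gg(2) ab(1,2)] k this]
    then show "g\<^sub>0 z $$ (a, b) = 0" "g\<^sub>1 w $$ (a, b) = 0" by auto
  qed
  show ?thesis
    using z holomorphic_GL_D(1)[OF gg(1)] holomorphic_GL_D(1)[OF gg(2)]
    by (cases x) (auto simp: eg block_lower_def)
qed

section \<open>Compatibility of restriction with the group structure, and the subgroup D_N\<close>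

lemma fiber_restriction_mult:
  "fiber_restriction (g \<otimes>\<^bsub>Aut_bundle s n i\<^esub> h) x = fiber_restriction g x * fiber_restriction h x"
  by (cases g; cases h; cases x) (simp_all add: Aut_bundle_mult)

lemma fiber_restriction_one: "fiber_restriction \<one>\<^bsub>Aut_bundle s n i\<^esub> x = 1\<^sub>m (rank s i)"
  by (cases x) (simp_all add: Aut_bundle_one)

text \<open>Block diagonal means block lower triangular for both the block order and its reverse, so
  the subgroup property comes from an intersection. The integers serve to negate the weight.\<close>

lemma D_subgroup_block_lower:
  "D_subgroup s i = (\<lambda>A. (\<lambda>z. A, \<lambda>w. A)) `
    (block_group s i \<inter> block_lower (rank s i) (\<lambda>a. - int (block (parts s i) a)))"
  unfolding D_subgroup_def block_lower_def by (auto simp: nat_neq_iff)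

lemma D_subgroup_carrier: "D_subgroup s i \<subseteq> carrier (Aut_bundle s n i)"
proof
  fix g assume "g \<in> D_subgroup s i"
  then obtain A where g: "g = (\<lambda>z. A, \<lambda>w. A)" and A: "A \<in> carrier (GL (rank s i))"
    and A0: "\<And>a b. a < rank s i \<Longrightarrow> b < rank s i \<Longrightarrow> block (parts s i) a \<noteq> block (parts s i) b \<Longrightarrow> A $$ (a, b) = 0"
    by (auto simp: D_subgroup_def)
  have "z powi (n (block (parts s i) a) - n (block (parts s i) b)) * A $$ (a, b) = A $$ (a, b)"
    if "a < rank s i" "b < rank s i" for a b z
    using A0[OF that] by (cases "block (parts s i) a = block (parts s i) b") auto
  then have "twist s n i z A = A" for z
    using GL_carrier_mat[OF A] by (intro eq_matI) (auto simp: twist_def)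
  then show "g \<in> carrier (Aut_bundle s n i)"
    using A by (simp add: g Aut_bundle_carrier holomorphic_GL_const)
qed

lemma subgroup_D_subgroup: "subgroup (D_subgroup s i) (Aut_bundle s n i)"
proof -
  let ?r = "rank s i"
  let ?H = "block_group s i \<inter> block_lower ?r (\<lambda>a. - int (block (parts s i) a))"
  have H: "subgroup ?H (GL ?r)"
    by (intro group.subgroups_Inter_pair[OF group_GL] subgroup_block_lower)
  interpret group "Aut_bundle s n i" by (rule Aut_bundle_group)
  show ?thesis
  proof (rule subgroupI[OF D_subgroup_carrier])
    show "D_subgroup s i \<noteq> {}"
      unfolding D_subgroup_block_lower using subgroup.one_closed[OF H] by blast
  next
    fix g assume g: "g \<in> D_subgroup s i"
    then obtain A where A: "A \<in> ?H" "g = (\<lambda>z. A, \<lambda>w. A)" unfolding D_subgroup_block_lower by blast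
    let ?B = "inv\<^bsub>GL ?r\<^esub> A"
    have B: "(\<lambda>z. ?B, \<lambda>w. ?B) \<in> D_subgroup s i"
      unfolding D_subgroup_block_lower using subgroup.m_inv_closed[OF H A(1)] by blast
    have "(\<lambda>z. ?B, \<lambda>w. ?B) \<otimes>\<^bsub>Aut_bundle s n i\<^esub> g = \<one>\<^bsub>Aut_bundle s n i\<^esub>"
      using GL_inv(2)[OF subgroup.mem_carrier[OF H A(1)]] by (simp add: A(2) Aut_bundle_mult Aut_bundle_one)
    from inv_equality[OF this D_subgroup_carrier[THEN subsetD, OF g] D_subgroup_carrier[THEN subsetD, OF B]]
    show "inv\<^bsub>Aut_bundle s n i\<^esub> g \<in> D_subgroup s i"
      using B by simp
  next
    fix g h assume "g \<in> D_subgroup s i" "h \<in> D_subgroup s i"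
    then obtain A B where A: "A \<in> ?H" "g = (\<lambda>z. A, \<lambda>w. A)" and B: "B \<in> ?H" "h = (\<lambda>z. B, \<lambda>w. B)"
      unfolding D_subgroup_block_lower by blast
    have "A * B \<in> ?H" using subgroup.m_closed[OF H A(1) B(1)] by (simp add: GL_simps(2))
    then show "g \<otimes>\<^bsub>Aut_bundle s n i\<^esub> h \<in> D_subgroup s i"
      unfolding A(2) B(2) Aut_bundle_mult D_subgroup_block_lower by auto
  qed
qed

subsection \<open>Automorphisms with prescribed restrictions\<close>

text \<open>The same section of \<open>\<O>(d)\<close> in the coordinate at infinity. The reversal
  is relative to the fixed d and not to the degree of p, so that the value at 0 is the coefficient
  of degree d even when it vanishes.\<close>

definition reverse_poly :: "nat \<Rightarrow> complex poly \<Rightarrow> complex poly" where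
  "reverse_poly d p = (\<Sum>t\<le>d. monom (coeff p (d - t)) t)"

lemma poly_reverse_poly:
  assumes "degree p \<le> d" "z \<noteq> 0"
  shows "poly p z = z ^ d * poly (reverse_poly d p) (1 / z)"
proof -
  have "poly p z = (\<Sum>t\<le>d. coeff p t * z ^ t)"
    unfolding poly_altdef using assms(1) by (intro sum.mono_neutral_left) (auto simp: coeff_eq_0)
  also have "\<dots> = (\<Sum>t\<le>d. coeff p (d - t) * z ^ (d - t))"
    by (rule sum.reindex_bij_witness[of _ "\<lambda>t. d - t" "\<lambda>t. d - t"]) auto
  also have "\<dots> = (\<Sum>t\<le>d. z ^ d * (coeff p (d - t) * (1 / z) ^ t))"
    using assms(2) by (intro sum.cong) (auto simp: power_diff power_one_over field_simps)
  finally show ?thesis by (simp add: reverse_poly_def poly_sum poly_monom sum_distrib_left)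
qed

lemma poly_reverse_poly_0: "poly (reverse_poly d p) 0 = coeff p d"
proof -
  have "poly (reverse_poly d p) 0 = (\<Sum>t\<le>d. if t = 0 then coeff p d else 0)"
    unfolding reverse_poly_def poly_sum poly_monom by (intro sum.cong) auto
  then show ?thesis by simp
qed

lemma reverse_poly_0: "reverse_poly d 0 = 0"
  by (simp add: reverse_poly_def)

lemma reverse_poly_1: "reverse_poly 0 1 = 1"
  by (simp add: reverse_poly_def one_pCons monom_0)

section \<open>Types of points and the number of conditions on an entry\<close>

lemma point_type_le_iff:
  assumes "m \<le> last_point s n"
  shows "point_type n m \<le> q \<longleftrightarrow> m \<le> (\<Sum>p=1..q. gap n p)"
proof
  have "m \<le> (\<Sum>p=1..point_type n m. gap n p)"
    unfolding point_type_def
    by (rule LeastI[of _ "s - 1"]) (use assms in \<open>simp add: last_point_def\<close>)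
  moreover have "(\<Sum>p=1..point_type n m. gap n p) \<le> (\<Sum>p=1..q. gap n p)" if "point_type n m \<le> q"
    using that by (intro sum_mono2) auto
  ultimately show "m \<le> (\<Sum>p=1..q. gap n p)" if "point_type n m \<le> q" using that by fastforce
next
  show "point_type n m \<le> q" if "m \<le> (\<Sum>p=1..q. gap n p)"
    unfolding point_type_def using that by (rule Least_le)
qed

lemma point_type_less: "0 < s \<Longrightarrow> m \<le> last_point s n \<Longrightarrow> point_type n m < s"
  using point_type_le_iff[of m s n "s - 1"] by (simp add: last_point_def)

text \<open>The gaps telescope; monotonicity of n ensures that \<open>nat\<close> in
  \<open>gap\<close> does not truncate.\<close>

lemma sum_gap:
  assumes "strict_mono_on {1..s} n" "Suc q \<le> s"
  shows "int (\<Sum>p=1..q. gap n p) = n (Suc q) - n 1"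
  using assms(2)
proof (induction q)
  case (Suc q)
  then have "n (Suc q) < n (Suc (Suc q))"
    by (intro strict_mono_onD[OF assms(1)]) auto
  then show ?case using Suc by (simp add: gap_def)
qed simp

text \<open>The degree of the line bundle of which the entry (j, k) is a section. For increasing n
  it is 0 within the diagonal blocks, and it is truncated to 0 above them, where the polynomial
  chosen later is 0.\<close>

definition entry_degree :: "nat \<Rightarrow> (nat \<Rightarrow> int) \<Rightarrow> (nat \<Rightarrow> nat) \<Rightarrow> nat \<Rightarrow> nat \<Rightarrow> nat" where
  "entry_degree s n i j k = nat (n (block (parts s i) j) - n (block (parts s i) k))"

text \<open>Besides 0, the counted indices are those of the points of types from \<open>block k\<close> to
  \<open>block j - 1\<close>, and their gaps telescope.\<close>

lemma card_prescribed_points: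
  assumes n: "strict_mono_on {1..s} n" and jk: "j < rank s i" "k < rank s i"
    and less: "block (parts s i) k < block (parts s i) j"
  shows "card {m\<in>{0..last_point s n}. cell_free s i (point_type n m) j k} \<le> Suc (entry_degree s n i j k)"
proof -
  define G where "G q = (\<Sum>p=1..q. gap n p)" for q
  let ?a = "block (parts s i) k" and ?b = "block (parts s i) j"
  have b: "1 \<le> ?a" "?b \<le> s" using block_parts_bounds jk by auto
  have type: "point_type n m \<le> q \<longleftrightarrow> m \<le> G q" if "m \<le> last_point s n" for m q
    using point_type_le_iff[OF that] by (simp add: G_def)
  have range: "m = 0 \<or> G (?a - 1) < m \<and> m \<le> G (?b - 1)"
    if m: "m \<le> last_point s n" "cell_free s i (point_type n m) j k" for m
  proof (cases "point_type n m = 0")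
    case True
    then show ?thesis using type[OF m(1), of 0] by (simp add: G_def)
  next
    case False
    then have "?a \<le> point_type n m" "point_type n m < ?b" using m(2) by (auto simp: cell_free_def)
    then show ?thesis using type[OF m(1), of "?a - 1"] type[OF m(1), of "?b - 1"] b less by auto
  qed
  have "{m\<in>{0..last_point s n}. cell_free s i (point_type n m) j k} \<subseteq> insert 0 {G (?a - 1)<..G (?b - 1)}"
  proof
    fix m assume "m \<in> {m\<in>{0..last_point s n}. cell_free s i (point_type n m) j k}"
    then show "m \<in> insert 0 {G (?a - 1)<..G (?b - 1)}" using range[of m] by auto
  qed
  then have "card {m\<in>{0..last_point s n}. cell_free s i (point_type n m) j k} \<le> Suc (G (?b - 1) - G (?a - 1))"
    by (rule card_mono[THEN order_trans, rotated]) (auto simp: card_insert_if)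
  moreover have "G (?b - 1) - G (?a - 1) = entry_degree s n i j k"
  proof -
    have "int (G (?b - 1)) = n ?b - n 1" "int (G (?a - 1)) = n ?a - n 1"
      using sum_gap[OF n, of "?b - 1"] sum_gap[OF n, of "?a - 1"] b less
      by (simp_all add: G_def del: of_nat_sum)
    then show ?thesis unfolding entry_degree_def by linarith
  qed
  ultimately show ?thesis by simp
qed

lemma section_interpolation_indexed:
  fixes v :: "'a \<Rightarrow> complex"
  assumes "finite M" "inj_on z M" "card M \<le> Suc d"
  shows "\<exists>p. degree p \<le> d \<and> (\<forall>m\<in>M. section_value d p (z m) = v m)"
  using section_interpolation[of "z ` M" d "\<lambda>x. v (inv_into M z x)"] assms
  by (simp add: card_image)

text \<open>The last clause is the entry (j, k) of \<open>h = U m * strip h\<close> at a free place: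
  the index p = j contributes nothing because (j, k) itself is deleted, and the remaining p are
  those where a unipotent \<open>U m\<close> may be nonzero.\<close>

lemma ex_polynomial_matrix:
  assumes n: "strict_mono_on {1..s} n" and inj: "inj_on z {0..last_point s n}"
  fixes U :: "nat \<Rightarrow> complex mat"
  shows "\<exists>H. \<forall>j<rank s i. \<forall>k<rank s i.
    degree (H j k) \<le> entry_degree s n i j k \<and>
    (block (parts s i) j \<le> block (parts s i) k \<longrightarrow> H j k = (if j = k then 1 else 0)) \<and>
    (\<forall>m\<in>{0..last_point s n}. cell_free s i (point_type n m) j k \<longrightarrow>
       section_value (entry_degree s n i j k) (H j k) (z m) =
       (\<Sum>p | p < rank s i \<and> cell_free s i (point_type n m) j p. U m $$ (j, p) *
          (if cell_free s i (point_type n m) p k then 0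
           else section_value (entry_degree s n i p k) (H p k) (z m))))"
proof -
  let ?b = "block (parts s i)" and ?D = "entry_degree s n i"
  let ?L = "{0..last_point s n}"
  define rhs where "rhs f j k m = (\<Sum>p | p < rank s i \<and> cell_free s i (point_type n m) j p. U m $$ (j, p) *
          (if cell_free s i (point_type n m) p k then 0 else section_value (?D p k) (f p k) (z m)))"
    for f :: "nat \<Rightarrow> nat \<Rightarrow> complex poly" and j k m
  \<comment> \<open>The bound on j is part of P because the choice below ranges over all natural
    numbers j.\<close>
  define P where "P f j row \<longleftrightarrow> j < rank s i \<longrightarrow> (\<forall>k<rank s i. degree (row k) \<le> ?D j k \<and>
      (?b j \<le> ?b k \<longrightarrow> row k = (if j = k then 1 else 0)) \<and>
      (\<forall>m\<in>?L. cell_free s i (point_type n m) j k \<longrightarrow> section_value (?D j k) (row k) (z m) = rhs f j k m))"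
    for f j and row :: "nat \<Rightarrow> complex poly"
  \<comment> \<open>Whole rows are chosen by well-founded recursion on the block number:
    \<open>rhs\<close> consults only rows p with (j, p) free, and these lie in earlier
    blocks.\<close>
  have "\<exists>H. \<forall>j. P H j (H j)"
  proof (rule dependent_wf_choice[of "Wellfounded.measure ?b"])
    fix f g :: "nat \<Rightarrow> nat \<Rightarrow> complex poly" and j row
    assume fg: "\<And>p. (p, j) \<in> Wellfounded.measure ?b \<Longrightarrow> f p = g p"
    have "rhs f j k m = rhs g j k m" for k m
      unfolding rhs_def using fg by (intro sum.cong refl) (auto simp: cell_free_def)
    then show "P f j row = P g j row" by (simp add: P_def)
  next
    fix j and f :: "nat \<Rightarrow> nat \<Rightarrow> complex poly"
    have "\<exists>q. degree q \<le> ?D j k \<and> (?b j \<le> ?b k \<longrightarrow> q = (if j = k then 1 else 0)) \<and>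
      (\<forall>m\<in>?L. cell_free s i (point_type n m) j k \<longrightarrow> section_value (?D j k) q (z m) = rhs f j k m)"
      if jk: "j < rank s i" "k < rank s i" for k
    proof (cases "?b j \<le> ?b k")
      case True
      then have "\<not> cell_free s i l j k" for l by (simp add: cell_free_def)
      then show ?thesis by (intro exI[of _ "if j = k then 1 else 0"]) auto
    next
      case False
      let ?M = "{m\<in>?L. cell_free s i (point_type n m) j k}"
      have "inj_on z ?M" using inj by (rule inj_on_subset) auto
      then obtain q where "degree q \<le> ?D j k" "\<forall>m\<in>?M. section_value (?D j k) q (z m) = rhs f j k m"
        using section_interpolation_indexed[of ?M z "?D j k" "rhs f j k"]
          card_prescribed_points[OF n jk] False by auto
      then show ?thesis using False by auto
    qed
    then show "\<exists>row. P f j row" unfolding P_def by metis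
  qed simp
  then show ?thesis unfolding P_def rhs_def by blast
qed

text \<open>At the free places the equation is what the interpolation achieves. At the other places
  it holds automatically, because \<open>h\<close> is block lower triangular and \<open>U m\<close>
  is the unit matrix off the free places.\<close>

lemma ex_automorphism:
  assumes s: "0 < s" and n: "strict_mono_on {1..s} n" and inj: "inj_on z {0..last_point s n}"
    and U: "\<And>m. m \<in> {0..last_point s n} \<Longrightarrow>
      U m \<in> bruhat_group (cell_partition s i (point_type n m)) (cell_perm s i (point_type n m))"
  shows "\<exists>h\<in>carrier (Aut_bundle s n i). \<forall>m\<in>{0..last_point s n}.
    fiber_restriction h (z m) = U m * strip s i (point_type n m) (fiber_restriction h (z m))"
proof -
  let ?b = "block (parts s i)" and ?D = "entry_degree s n i" and ?r = "rank s i"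
  obtain H where H: "\<And>j k. j < ?r \<Longrightarrow> k < ?r \<Longrightarrow> degree (H j k) \<le> ?D j k"
    "\<And>j k. j < ?r \<Longrightarrow> k < ?r \<Longrightarrow> ?b j \<le> ?b k \<Longrightarrow> H j k = (if j = k then 1 else 0)"
    "\<And>j k m. j < ?r \<Longrightarrow> k < ?r \<Longrightarrow> m \<in> {0..last_point s n} \<Longrightarrow> cell_free s i (point_type n m) j k \<Longrightarrow>
       section_value (?D j k) (H j k) (z m) =
       (\<Sum>p | p < ?r \<and> cell_free s i (point_type n m) j p. U m $$ (j, p) *
          (if cell_free s i (point_type n m) p k then 0 else section_value (?D p k) (H p k) (z m)))"
    using ex_polynomial_matrix[OF n inj, of i U] by blast
  define g\<^sub>0 where "g\<^sub>0 x = mat ?r ?r (\<lambda>(j, k). poly (H j k) x)" for x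
  define g\<^sub>1 where "g\<^sub>1 x = mat ?r ?r (\<lambda>(j, k). poly (reverse_poly (?D j k) (H j k)) x)" for x
  have mono: "?b j \<le> ?b k" if "j \<le> k" "k < ?r" for j k
    using block_mono[of j k "parts s i"] that by (simp add: sum_list_parts)
  have "g\<^sub>0 x \<in> carrier (GL ?r)" for x
    using H(2) mono by (intro unitriangular_GL) (auto simp: g\<^sub>0_def)
  then have g0: "g\<^sub>0 \<in> holomorphic_GL ?r"
    by (auto simp: holomorphic_GL_def g\<^sub>0_def intro!: holomorphic_intros)
  \<comment> \<open>Degree 0 on the diagonal makes the reversal of the constant 1 again 1, so
    \<open>g\<^sub>1\<close> is unitriangular as well.\<close>
  have D0: "?D j j = 0" for j by (simp add: entry_degree_def)
  have "g\<^sub>1 x \<in> carrier (GL ?r)" for x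
    using H(2) mono by (intro unitriangular_GL) (auto simp: g\<^sub>1_def D0 reverse_poly_0 reverse_poly_1)
  then have g1: "g\<^sub>1 \<in> holomorphic_GL ?r"
    by (auto simp: holomorphic_GL_def g\<^sub>1_def intro!: holomorphic_intros)
  have "g\<^sub>0 x = twist s n i x (g\<^sub>1 (1 / x))" if x: "x \<noteq> 0" for x
  proof (rule eq_matI)
    fix j k assume "j < dim_row (twist s n i x (g\<^sub>1 (1 / x)))" "k < dim_col (twist s n i x (g\<^sub>1 (1 / x)))"
    then have jk: "j < ?r" "k < ?r" by (simp_all add: twist_def)
    show "g\<^sub>0 x $$ (j, k) = twist s n i x (g\<^sub>1 (1 / x)) $$ (j, k)"
    proof (cases "?b j < ?b k")
      case True
      then have "H j k = 0" using H(2)[OF jk] by auto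
      then show ?thesis using jk by (simp add: twist_entry g\<^sub>0_def g\<^sub>1_def reverse_poly_0)
    next
      case False
      then have "n (?b k) \<le> n (?b j)"
        using strict_mono_on_leD[OF n, of "?b k" "?b j"] block_parts_bounds jk by auto
      then have "n (?b j) - n (?b k) = int (?D j k)" by (simp add: entry_degree_def)
      then show ?thesis
        using jk poly_reverse_poly[OF H(1)[OF jk] x] by (simp add: twist_entry g\<^sub>0_def g\<^sub>1_def)
    qed
  qed (simp_all add: twist_def g\<^sub>0_def)
  then have h: "(g\<^sub>0, g\<^sub>1) \<in> carrier (Aut_bundle s n i)"
    using g0 g1 by (simp add: Aut_bundle_carrier)
  have val: "fiber_restriction (g\<^sub>0, g\<^sub>1) x $$ (j, k) = section_value (?D j k) (H j k) x"
    if "j < ?r" "k < ?r" for x j k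
    using that by (cases x) (simp_all add: g\<^sub>0_def g\<^sub>1_def poly_reverse_poly_0)
  have "fiber_restriction (g\<^sub>0, g\<^sub>1) (z m) =
      U m * strip s i (point_type n m) (fiber_restriction (g\<^sub>0, g\<^sub>1) (z m))"
    if m: "m \<in> {0..last_point s n}" for m
  proof -
    let ?l = "point_type n m"
    let ?A = "fiber_restriction (g\<^sub>0, g\<^sub>1) (z m)"
    have l: "?l < s" using point_type_less[OF s] m by simp
    have Uc: "U m \<in> carrier_mat ?r ?r"
      and Ue: "\<And>j k. j < ?r \<Longrightarrow> k < ?r \<Longrightarrow> \<not> cell_free s i ?l j k \<Longrightarrow> U m $$ (j, k) = (if j = k then 1 else 0)"
      using U[OF m] by (auto simp: bruhat_group_iff[OF l])
    have A: "?A \<in> block_group s i" using Aut_bundle_block_group[OF n h] .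
    have nf: "\<not> cell_free s i ?l j j" for j by (simp add: cell_free_def)
    show ?thesis
    proof (rule eq_matI)
      fix j k assume "j < dim_row (U m * strip s i ?l ?A)" "k < dim_col (U m * strip s i ?l ?A)"
      then have jk: "j < ?r" "k < ?r" using Uc by (simp_all add: strip_def)
      have prod: "(U m * strip s i ?l ?A) $$ (j, k) =
          (\<Sum>p<?r. U m $$ (j, p) * (if cell_free s i ?l p k then 0 else ?A $$ (p, k)))"
        unfolding mult_mat_entry[OF Uc strip_carrier jk]
        using jk by (intro sum.cong) (auto simp: strip_entry)
      show "?A $$ (j, k) = (U m * strip s i ?l ?A) $$ (j, k)"
      proof (cases "cell_free s i ?l j k")
        case True
        \<comment> \<open>The term p = j vanishes since (j, k) is deleted; for any other p with (j,
          p) not free, the entry of \<open>U m\<close> is 0.\<close>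
        have "(\<Sum>p<?r. U m $$ (j, p) * (if cell_free s i ?l p k then 0 else ?A $$ (p, k))) =
            (\<Sum>p | p < ?r \<and> cell_free s i ?l j p. U m $$ (j, p) *
              (if cell_free s i ?l p k then 0 else ?A $$ (p, k)))"
          using True Ue[OF jk(1)] by (intro sum.mono_neutral_right) auto
        also have "\<dots> = (\<Sum>p | p < ?r \<and> cell_free s i ?l j p. U m $$ (j, p) *
              (if cell_free s i ?l p k then 0 else section_value (?D p k) (H p k) (z m)))"
          using val[OF _ jk(2)] by (intro sum.cong) auto
        finally show ?thesis unfolding prod using H(3)[OF jk m True] val[OF jk] by simp
      next
        case False
        have "U m $$ (j, p) * (if cell_free s i ?l p k then 0 else ?A $$ (p, k)) =
            (if p = j then ?A $$ (j, k) else 0)" if p: "p < ?r" for p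
        proof (cases "p = j")
          case True
          then show ?thesis using False Ue[OF jk(1) jk(1) nf] by simp
        next
          case pj: False
          show ?thesis
          proof (cases "cell_free s i ?l j p")
            case True
            then have "?b p < ?b j" by (simp add: cell_free_def)
            \<comment> \<open>Otherwise the block of p would lie between those of k and j, and
              \<open>cell_free_split\<close> would make (j, k) free.\<close>
            then have "?b p < ?b k" using cell_free_split[of s i k p j ?l] True False
              by (intro not_le_imp_less) auto
            then have "?A $$ (p, k) = 0" using block_groupD(3)[OF A p jk(2)] by simp
            then show ?thesis using pj by simp
          qed (use Ue[OF jk(1) p] pj in simp)
        qed
        then have "(U m * strip s i ?l ?A) $$ (j, k) = (\<Sum>p<?r. if p = j then ?A $$ (j, k) else 0)"
          unfolding prod by (intro sum.cong) auto
        then show ?thesis using jk by simp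
      qed
    qed (use Uc block_groupD(2)[OF A] in \<open>auto simp: strip_def\<close>)
  qed
  then show ?thesis using h by blast
qed

subsection \<open>The action on the product of cells\<close>

text \<open>The map of the inverse element inverts \<open>\<phi> g\<close>, so bijectivity needs no
  separate assumption. Extensionality turns the pointwise product rule into an equality of
  functions, which a homomorphism into \<open>BijGroup E\<close> demands.\<close>

lemma group_actionI:
  assumes G: "group G"
    and ext: "\<And>g. g \<in> carrier G \<Longrightarrow> \<phi> g \<in> extensional E"
    and closed: "\<And>g x. g \<in> carrier G \<Longrightarrow> x \<in> E \<Longrightarrow> \<phi> g x \<in> E"
    and one: "\<And>x. x \<in> E \<Longrightarrow> \<phi> \<one>\<^bsub>G\<^esub> x = x"
    and mult: "\<And>g h x. g \<in> carrier G \<Longrightarrow> h \<in> carrier G \<Longrightarrow> x \<in> E \<Longrightarrow> \<phi> (g \<otimes>\<^bsub>G\<^esub> h) x = \<phi> g (\<phi> h x)"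
  shows "group_action G E \<phi>"
proof -
  interpret group G by (rule G)
  have inverse: "\<phi> (inv\<^bsub>G\<^esub> g) (\<phi> g x) = x" "\<phi> g (\<phi> (inv\<^bsub>G\<^esub> g) x) = x"
    if "g \<in> carrier G" "x \<in> E" for g x
    using mult[of "inv\<^bsub>G\<^esub> g" g x] mult[of g "inv\<^bsub>G\<^esub> g" x] one that by simp_all
  have bij: "\<phi> g \<in> Bij E" if "g \<in> carrier G" for g
    unfolding Bij_def using ext[OF that] inverse[OF that] closed that
    by (auto intro!: bij_betw_byWitness[of E "\<phi> (inv\<^bsub>G\<^esub> g)"])
  have "\<phi> (g \<otimes>\<^bsub>G\<^esub> h) = compose E (\<phi> g) (\<phi> h)" if "g \<in> carrier G" "h \<in> carrier G" for g h
    using ext[of "g \<otimes>\<^bsub>G\<^esub> h"] mult that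
    by (intro extensionalityI[of _ E]) (auto simp: compose_eq)
  then have "group_hom G (BijGroup E) \<phi>"
    using bij group_BijGroup[of E]
    by (intro group_hom.intro group_hom_axioms.intro homI G) (auto simp: BijGroup_def)
  then show ?thesis by (rule group_action.intro)
qed

context
  fixes s :: nat and n :: "nat \<Rightarrow> int" and i :: "nat \<Rightarrow> nat" and z :: "nat \<Rightarrow> cp1"
  assumes s: "0 < s" and n: "strict_mono_on {1..s} n"
begin

lemma cell_product_mem:
  assumes "F \<in> cell_product s n i" "m \<in> {0..last_point s n}"
  shows "F m \<in> cell_of s i (point_type n m)"
  using assms by (auto simp: cell_product_def)

lemma cell_action_apply:
  assumes "F \<in> cell_product s n i" "m \<in> {0..last_point s n}"
  shows "cell_action s n i z g F m = fiber_restriction g (z m) <#\<^bsub>GL (rank s i)\<^esub> F m"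
  using assms by (simp add: cell_action_def)

lemma cell_action_closed:
  assumes g: "g \<in> carrier (Aut_bundle s n i)" and F: "F \<in> cell_product s n i"
  shows "cell_action s n i z g F \<in> cell_product s n i"
proof -
  have "fiber_restriction g (z m) <#\<^bsub>GL (rank s i)\<^esub> F m \<in> cell_of s i (point_type n m)"
    if "m \<in> {0..last_point s n}" for m
    using lcos_cell_closed[OF _ Aut_bundle_block_group[OF n g] cell_product_mem[OF F that]]
      point_type_less[OF s, of m n] that by simp
  then show ?thesis using F by (auto simp: cell_action_def cell_product_def)
qed

lemma cell_action_eqI:
  assumes "F \<in> cell_product s n i" "F' \<in> cell_product s n i"
    and "\<And>m. m \<in> {0..last_point s n} \<Longrightarrow> F m = F' m"
  shows "F = F'"
  using assms unfolding cell_product_def by (intro PiE_ext[of F _ _ F']) auto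

lemma group_action_cell_product:
  "group_action (Aut_bundle s n i) (cell_product s n i) (cell_action s n i z)"
proof (rule group_actionI[OF Aut_bundle_group])
  let ?G = "Aut_bundle s n i"
  show "cell_action s n i z g \<in> extensional (cell_product s n i)" for g
    by (simp add: cell_action_def)
  show "cell_action s n i z g F \<in> cell_product s n i"
    if "g \<in> carrier ?G" "F \<in> cell_product s n i" for g F
    using cell_action_closed[OF that] .
  have sub: "F m \<subseteq> carrier (GL (rank s i))" if "F \<in> cell_product s n i" "m \<in> {0..last_point s n}" for F m
    using cell_of_subset[OF _ cell_product_mem[OF that]] point_type_less[OF s, of m n] that by simp
  show "cell_action s n i z \<one>\<^bsub>?G\<^esub> F = F" if F: "F \<in> cell_product s n i" for F
  proof (rule cell_action_eqI[OF cell_action_closed[OF _ F] F])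
    show "\<one>\<^bsub>?G\<^esub> \<in> carrier ?G"
      using group.is_monoid[OF Aut_bundle_group] by (rule monoid.one_closed)
    fix m assume m: "m \<in> {0..last_point s n}"
    show "cell_action s n i z \<one>\<^bsub>?G\<^esub> F m = F m"
      using group.lcos_mult_one[OF group_GL sub[OF F m]]
      unfolding cell_action_apply[OF F m] fiber_restriction_one by (simp add: GL_simps(3))
  qed
  fix g h F assume g: "g \<in> carrier ?G" and h: "h \<in> carrier ?G" and F: "F \<in> cell_product s n i"
  show "cell_action s n i z (g \<otimes>\<^bsub>?G\<^esub> h) F = cell_action s n i z g (cell_action s n i z h F)"
  proof (rule cell_action_eqI)
    show "cell_action s n i z (g \<otimes>\<^bsub>?G\<^esub> h) F \<in> cell_product s n i"
      using monoid.m_closed[OF group.is_monoid[OF Aut_bundle_group] g h] F by (rule cell_action_closed)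
    show "cell_action s n i z g (cell_action s n i z h F) \<in> cell_product s n i"
      by (intro cell_action_closed g h F)
    fix m assume m: "m \<in> {0..last_point s n}"
    show "cell_action s n i z (g \<otimes>\<^bsub>?G\<^esub> h) F m = cell_action s n i z g (cell_action s n i z h F) m"
      unfolding cell_action_apply[OF cell_action_closed[OF h F] m] cell_action_apply[OF F m]
        fiber_restriction_mult
      using block_groupD(1)[OF Aut_bundle_block_group[OF n g]]
        block_groupD(1)[OF Aut_bundle_block_group[OF n h]] sub[OF F m]
      by (intro GL_lcos_assoc[symmetric])
  qed
qed

lemma special_element_mem: "special_element s n i \<in> cell_product s n i"
  using flag_of_in_cell point_type_less[OF s]
  by (auto simp: special_element_def cell_product_def)

text \<open>Each flag is represented by a matrix \<open>U m\<close> of the unipotent group, and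
  \<open>h(z m)\<close> differs from \<open>U m\<close> by a right factor that stabilizes the
  special flag.\<close>

lemma ex_cell_action_special:
  assumes inj: "inj_on z {0..last_point s n}" and F: "F \<in> cell_product s n i"
  shows "\<exists>h\<in>carrier (Aut_bundle s n i). cell_action s n i z h (special_element s n i) = F"
proof -
  let ?N = "\<lambda>l. bruhat_group (cell_partition s i l) (cell_perm s i l)"
  have "\<exists>U. U \<in> ?N (point_type n m) \<and> F m = U <#\<^bsub>GL (rank s i)\<^esub> flag_of s i (point_type n m)"
    if "m \<in> {0..last_point s n}" for m
    using cell_product_mem[OF F that] cell_of_eq_image[of "point_type n m" s i]
      point_type_less[OF s, of m n] that by auto
  then obtain U where U: "\<And>m. m \<in> {0..last_point s n} \<Longrightarrow> U m \<in> ?N (point_type n m)"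
    "\<And>m. m \<in> {0..last_point s n} \<Longrightarrow> F m = U m <#\<^bsub>GL (rank s i)\<^esub> flag_of s i (point_type n m)"
    by metis
  obtain h where h: "h \<in> carrier (Aut_bundle s n i)"
    "\<And>m. m \<in> {0..last_point s n} \<Longrightarrow>
      fiber_restriction h (z m) = U m * strip s i (point_type n m) (fiber_restriction h (z m))"
    using ex_automorphism[OF s n inj U(1)] by blast
  have "cell_action s n i z h (special_element s n i) = F"
  proof (rule cell_action_eqI[OF cell_action_closed[OF h(1) special_element_mem] F])
    fix m assume m: "m \<in> {0..last_point s n}"
    have l: "point_type n m < s" using point_type_less[OF s] m by simp
    show "cell_action s n i z h (special_element s n i) m = F m"
      unfolding cell_action_apply[OF special_element_mem m] U(2)[OF m]
      using lcos_flag_eq[OF l Aut_bundle_block_group[OF n h(1)] U(1)[OF m] h(2)[OF m]] m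
      by (simp add: special_element_def)
  qed
  then show ?thesis using h(1) by blast
qed

text \<open>Rows of different weight lie in different blocks, by
  \<open>cell_weight_less_iff\<close>. A block diagonal matrix is therefore block lower triangular
  for the weight of every cell, and it acts by the same matrix on all fibers.\<close>

lemma D_subgroup_stabilizes:
  "D_subgroup s i \<subseteq> stabilizer (Aut_bundle s n i) (cell_action s n i z) (special_element s n i)"
proof
  fix g assume gD: "g \<in> D_subgroup s i"
  then have g: "g \<in> carrier (Aut_bundle s n i)" using D_subgroup_carrier by blast
  obtain A where A: "g = (\<lambda>z. A, \<lambda>w. A)" "A \<in> carrier (GL (rank s i))"
    "\<And>a b. a < rank s i \<Longrightarrow> b < rank s i \<Longrightarrow> block (parts s i) a \<noteq> block (parts s i) b \<Longrightarrow> A $$ (a, b) = 0"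
    using gD by (auto simp: D_subgroup_def)
  have fr: "fiber_restriction g x = A" for x by (cases x) (simp_all add: A(1))
  have "cell_action s n i z g (special_element s n i) = special_element s n i"
  proof (rule cell_action_eqI[OF cell_action_closed[OF g special_element_mem] special_element_mem])
    fix m assume m: "m \<in> {0..last_point s n}"
    have l: "point_type n m < s" using point_type_less[OF s] m by simp
    have "A $$ (j, k) = 0"
      if "j < rank s i" "k < rank s i" "cell_weight s i (point_type n m) j < cell_weight s i (point_type n m) k" for j k
    proof -
      have "block (parts s i) j \<noteq> block (parts s i) k"
        using cell_weight_less_iff[OF l that(1,2)] that(3) by (auto simp: cell_free_def)
      then show ?thesis using A(3) that by blast
    qed
    then have "A \<in> block_lower (rank s i) (cell_weight s i (point_type n m))"
      using A(2) by (simp add: block_lower_def)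
    from flag_of_stabilizer[OF l this]
    show "cell_action s n i z g (special_element s n i) m = special_element s n i m"
      unfolding cell_action_apply[OF special_element_mem m] fr using m by (simp add: special_element_def)
  qed
  then show "g \<in> stabilizer (Aut_bundle s n i) (cell_action s n i z) (special_element s n i)"
    using g by (simp add: stabilizer_def)
qed

end

theorem corollary3:
  fixes s :: nat and n :: "nat \<Rightarrow> int" and i :: "nat \<Rightarrow> nat" and z :: "nat \<Rightarrow> cp1"
  assumes "2 \<le> s"
    and "strict_mono_on {1..s} n"
    and "\<And>k. k \<in> {1..s} \<Longrightarrow> 0 < i k"
    and "z 0 = Fin 0"
    and "inj_on z {0..last_point s n}"
  shows "group_action (Aut_bundle s n i) (cell_product s n i) (cell_action s n i z)
    \<and> special_element s n i \<in> cell_product s n i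
    \<and> (\<forall>F\<in>cell_product s n i. \<exists>g\<in>carrier (Aut_bundle s n i).
          cell_action s n i z g F = special_element s n i)
    \<and> subgroup (D_subgroup s i) (Aut_bundle s n i)
    \<and> D_subgroup s i
        \<subseteq> stabilizer (Aut_bundle s n i) (cell_action s n i z) (special_element s n i)"
proof -
  let ?G = "Aut_bundle s n i"
  have s: "0 < s" using assms(1) by simp
  note special = special_element_mem[OF s assms(2), of i]
  interpret group_action ?G "cell_product s n i" "cell_action s n i z"
    using s assms(2) by (rule group_action_cell_product)
  have "\<exists>g\<in>carrier ?G. cell_action s n i z g F = special_element s n i" if F: "F \<in> cell_product s n i" for F
  proof -
    obtain h where h: "h \<in> carrier ?G" "cell_action s n i z h (special_element s n i) = F"
      using ex_cell_action_special[OF s assms(2,5) F] by blast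
    then have "cell_action s n i z (inv\<^bsub>?G\<^esub> h) F = special_element s n i"
      using orbit_sym_aux[OF h(1) special] by simp
    then show ?thesis using group.inv_closed[OF Aut_bundle_group h(1)] by blast
  qed
  then show ?thesis
    using group_action_axioms special subgroup_D_subgroup D_subgroup_stabilizes[OF s assms(2)]
    by blast
qed

end
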